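(* Let $n\in\mathbb{N}$, $d\in(0,n)$, $c>1$, and let $S\subset Q_{0,0}=[0,1]^n$ be a compact set with $\lambda_S:=\mathcal{H}^d_\infty(S)>0$. Then, for each $\lambda\in\bigl(0,\frac{\lambda_S}{c^d6^n}\bigr)$, there exist positive constants $\operatorname{C}_i=\operatorname{C}_i(n,\lambda,d,c)$, $i=1,2,3$ (depending only on $n,\lambda,d,c$), and a countable family of Borel sets $\mathcal{W}_S=\mathcal{W}_S(d,\lambda,c)$ such that: (i) $\operatorname{int}(cQ_{0,0})\setminus S=\bigcup\{\Omega:\Omega\in\mathcal{W}_S\}$; (ii) for every $\Omega\in\mathcal{W}_S$, $\ \frac{1}{\operatorname{C}_1}\operatorname{diam}\Omega\le\operatorname{D}_{S,d,\lambda}(\Omega,S)\le\operatorname{C}_1\operatorname{diam}\Omega$; (iii) for every $\Omega\in\mathcal{W}_S$, $\ \mathcal{L}^n(\Omega)\ge\operatorname{C}_2(\operatorname{diam}\Omega)^n$; (iv) $M(\mathcal{W}_S)\le\operatorname{C}_3$.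
   Context: $\mathbb{R}^n$ carries the norm $\|x\|_\infty=\max_i|x_i|$, and diameters are taken in this norm. A cube is a closed cube with sides parallel to the coordinate axes; $l(Q)$ is its side length; $cQ$ is the dilation of $Q$ by the factor $c$ about its center. $\mathcal{L}^n$ is Lebesgue measure. $d$-Hausdorff content: $\mathcal{H}^d_\infty(E):=\inf\sum_{F\in\mathcal{F}}(\operatorname{diam}F)^d$, the infimum being over all at most countable coverings $\mathcal{F}$ of $E$ by subsets of $\mathbb{R}^n$ with $\sup_{F\in\mathcal F}\operatorname{diam}F<\infty$. $\mathcal{F}_S(d,\lambda):=\{Q \text{ a cube}:\ \mathcal{H}^d_\infty(Q\cap S)\ge\lambda (l(Q))^d\}$. For $x\ne y$ in $\mathbb{R}^n$ let $\widetilde{\rho}_\lambda(x,y):=\inf\{l(Q):Q\in\mathcal{F}_S(d,\lambda),\ x,y\in Q\}$ ($+\infty$ if there is no such $Q$), and $\widetilde{\rho}_\lambda(x,x):=0$. For $x\in\mathbb{R}^n$ and $\xi\in S$ let $\rho_\lambda(x,\xi):=\inf\sum_{i=0}^{N-1}\widetilde{\rho}_\lambda(x^i,x^{i+1})$, the infimum over all finite sequences $x=x^0,x^1,\dots,x^N=\xi$ in $\mathbb{R}^n$. For nonempty $E\subset\mathbb{R}^n\setminus S$, $\operatorname{D}_{S,d,\lambda}(E,S):=\inf\{\rho_\lambda(x,\xi):x\in E,\ \xi\in S\}$. For a family $\mathcal{G}$ of subsets of $\mathbb{R}^n$, $M(\mathcal{G})$ is its covering multiplicity: the minimal $M'\in\mathbb{N}$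 such that every point of $\mathbb{R}^n$ belongs to at most $M'$ sets from $\mathcal{G}$. *)

theory Defs
  imports "HOL-Analysis.Analysis"
begin

text \<open>Diameter in the maximum norm. It takes values in \<open>[0,\<infinity>]\<close>, so that unbounded sets have
  diameter \<open>\<infinity>\<close>; the empty set has diameter 0. (The library constant for diameters refers to the
  Euclidean norm.)\<close>

definition sup_diam :: "(real ^ 'n) set \<Rightarrow> ennreal" where
  "sup_diam E = (SUP x\<in>E. SUP y\<in>E. ennreal (infnorm (x - y)))"

text \<open>The conversion to a real number below loses nothing: all diameters in an admissible
  covering are finite. The power is used for \<open>d > 0\<close> only, where \<open>0 powr d = 0\<close>.\<close>

definition hausdorff_content :: "real \<Rightarrow> (real ^ 'n) set \<Rightarrow> ennreal" where
  "hausdorff_content d E =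
     (INF \<F>\<in>{\<F>. countable \<F> \<and> E \<subseteq> \<Union>\<F> \<and> (SUP F\<in>\<F>. sup_diam F) < \<infinity>}.
        infsum (\<lambda>F. ennreal (enn2real (sup_diam F) powr d)) \<F>)"

definition cube :: "real ^ 'n \<Rightarrow> real \<Rightarrow> (real ^ 'n) set" where
  "cube z l = cbox (\<chi> i. z $ i - l / 2) (\<chi> i. z $ i + l / 2)"

definition is_cube :: "(real ^ 'n) set \<Rightarrow> bool" where
  "is_cube Q \<longleftrightarrow> (\<exists>z l. l > 0 \<and> Q = cube z l)"

definition side_length :: "(real ^ 'n) set \<Rightarrow> real" where
  "side_length Q = (THE l. l > 0 \<and> (\<exists>z. Q = cube z l))"

definition cube_center :: "(real ^ 'n) set \<Rightarrow> real ^ 'n" where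
  "cube_center Q = (THE z. \<exists>l>0. Q = cube z l)"

definition dilate :: "real \<Rightarrow> (real ^ 'n) set \<Rightarrow> (real ^ 'n) set" where
  "dilate c Q = (\<lambda>x. cube_center Q + c *\<^sub>R (x - cube_center Q)) ` Q"

definition unit_cube :: "(real ^ 'n) set" where
  "unit_cube = {x. \<forall>i. 0 \<le> x $ i \<and> x $ i \<le> 1}"

definition thick_cubes :: "(real ^ 'n) set \<Rightarrow> real \<Rightarrow> real \<Rightarrow> (real ^ 'n) set set" where
  "thick_cubes S d lam =
     {Q. is_cube Q \<and> hausdorff_content d (Q \<inter> S) \<ge> ennreal (lam * side_length Q powr d)}"

text \<open>An infimum over the empty set is \<open>\<infinity>\<close> in \<^typ>\<open>ennreal\<close>.\<close>

definition rho_step :: "(real ^ 'n) set \<Rightarrow> real \<Rightarrow> real \<Rightarrow> real ^ 'n \<Rightarrow> real ^ 'n \<Rightarrow> ennreal" where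
  "rho_step S d lam x y =
     (if x = y then 0
      else (INF Q\<in>{Q \<in> thick_cubes S d lam. x \<in> Q \<and> y \<in> Q}. ennreal (side_length Q)))"

text \<open>A chain is a number \<open>N\<close> of steps together with a sequence of points, of which only those
  with index at most \<open>N\<close> matter.\<close>

definition rho :: "(real ^ 'n) set \<Rightarrow> real \<Rightarrow> real \<Rightarrow> real ^ 'n \<Rightarrow> real ^ 'n \<Rightarrow> ennreal" where
  "rho S d lam x \<xi> =
     (INF (N, p)\<in>{(N :: nat, p :: nat \<Rightarrow> real ^ 'n). p 0 = x \<and> p N = \<xi>}.
        \<Sum>i<N. rho_step S d lam (p i) (p (Suc i)))"

text \<open>The distance from \<open>E\<close> to \<open>S\<close>, meant for nonempty \<open>E\<close> disjoint from \<open>S\<close>. It is \<open>\<infinity>\<close> for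
  empty \<open>E\<close>, so an upper bound by a finite number forces \<open>E\<close> to be nonempty.\<close>

definition rho_dist :: "(real ^ 'n) set \<Rightarrow> real \<Rightarrow> real \<Rightarrow> (real ^ 'n) set \<Rightarrow> ennreal" where
  "rho_dist S d lam E = (INF x\<in>E. INF \<xi>\<in>S. rho S d lam x \<xi>)"

text \<open>The value is \<open>\<infinity>\<close> if no finite bound exists.\<close>

definition covering_multiplicity :: "'a set set \<Rightarrow> enat" where
  "covering_multiplicity \<G> =
     Inf {enat M | M. \<forall>x. finite {G \<in> \<G>. x \<in> G} \<and> card {G \<in> \<G>. x \<in> G} \<le> M}"

lemma mem_cube: "x \<in> cube z l \<longleftrightarrow> (\<forall>i. \<bar>x $ i - z $ i\<bar> \<le> l / 2)"
  unfolding cube_def mem_box_cart by (intro all_cong1) (simp only: vec_lambda_beta, arith)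

lemma cube_eq_iff:
  assumes "l > 0" "l' > 0"
  shows "cube z l = cube z' l' \<longleftrightarrow> z = z' \<and> l = l'"
proof
  assume eq: "cube z l = cube z' l'"
  have "z \<in> cube z l"
    using assms by (auto simp: cube_def mem_box_cart)
  hence "cbox (\<chi> i. z $ i - l / 2) (\<chi> i. z $ i + l / 2) \<noteq> {}"
    unfolding cube_def by blast
  with eq have *: "(\<chi> i. z $ i - l / 2) = (\<chi> i. z' $ i - l' / 2)"
      "(\<chi> i. z $ i + l / 2) = (\<chi> i. z' $ i + l' / 2)"
    unfolding cube_def by (auto simp: eq_cbox)
  have i: "z $ i = z' $ i \<and> l = l'" for i
    using arg_cong[OF *(1), of "\<lambda>v. v $ i"] arg_cong[OF *(2), of "\<lambda>v. v $ i"]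
    by simp
  thus "z = z' \<and> l = l'"
    by (simp add: vec_eq_iff)
qed auto

lemma side_length_cube: "l > 0 \<Longrightarrow> side_length (cube z l) = l"
  unfolding side_length_def by (rule the_equality) (auto simp: cube_eq_iff)

lemma cube_center_cube: "l > 0 \<Longrightarrow> cube_center (cube z l) = z"
  unfolding cube_center_def by (rule the_equality) (auto simp: cube_eq_iff)

lemma unit_cube_eq: "unit_cube = cube (\<chi> i. 1 / 2) 1"
  by (auto simp: unit_cube_def cube_def mem_box_cart)

lemma dilate_cube:
  assumes "c > 0" "l > 0"
  shows "dilate c (cube z l) = cube z (c * l)"
proof -
  have 1: "z + c *\<^sub>R (x - z) \<in> cube z (c * l)" if "x \<in> cube z l" for x
  proof -
    have "\<bar>x $ i - z $ i\<bar> \<le> l / 2" for i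
      using that by (auto simp: mem_cube)
    hence "c * \<bar>x $ i - z $ i\<bar> \<le> c * (l / 2)" for i
      using assms by simp
    hence "\<bar>c * (x $ i - z $ i)\<bar> \<le> c * l / 2" for i
      using assms by (simp add: abs_mult)
    thus ?thesis
      by (simp add: mem_cube)
  qed
  have 2: "x \<in> (\<lambda>x. z + c *\<^sub>R (x - z)) ` cube z l" if "x \<in> cube z (c * l)" for x
  proof
    show "x = z + c *\<^sub>R ((z + (1 / c) *\<^sub>R (x - z)) - z)"
      using assms by simp
    have "\<bar>x $ i - z $ i\<bar> \<le> c * l / 2" for i
      using that by (auto simp: mem_cube)
    hence "\<bar>(x $ i - z $ i) / c\<bar> \<le> l / 2" for i
      using assms by (simp add: field_simps)
    thus "z + (1 / c) *\<^sub>R (x - z) \<in> cube z l"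
      by (simp add: mem_cube)
  qed
  show ?thesis
    unfolding dilate_def cube_center_cube[OF assms(2)] using 1 2 by blast
qed

end

theory Submission
  imports Defs
begin

text \<open>
  A chain from a point \<open>x \<notin> S\<close> to \<open>S\<close> can be cut after its first nontrivial step, since every thick
  cube meets \<open>S\<close>. So the distance of \<open>x\<close> to \<open>S\<close> is the infimum \<open>D x\<close> of the sides of the thick
  cubes containing \<open>x\<close>, and \<open>{D < s}\<close> is the union \<open>thick_union\<close> of the thick cubes of side below
  \<open>s\<close>. It is Borel because the Hausdorff content is outer regular, so that limits of thick cubes are
  thick.

  At scale \<open>s = c / 2 ^ k\<close> the family consists of the sets \<open>{e s \<le> D < 2 s}\<close>, cut off by the
  fourfold dilates of those grid cubes that contain a point with \<open>s \<le> D < 2 s\<close>. Such a point lies in a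
  thick cube of side below \<open>2 s\<close>, which contains a smaller cube \<open>P\<close> through the point, of side
  comparable to \<open>s\<close> but below \<open>s\<close>; hence \<open>P\<close> is not thick. Since \<open>d < n\<close>, the set \<open>S\<close> and
  the much smaller thick cubes leave a fixed proportion of the volume of \<open>P\<close> uncovered, which gives
  the volume bound. A given value of \<open>D\<close> occurs in boundedly many scales only.
\<close>

section \<open>Hausdorff content via sequences of sets\<close>

lemma infnorm_cart_le_iff: "infnorm (x :: real ^ 'n) \<le> r \<longleftrightarrow> (\<forall>i. \<bar>x $ i\<bar> \<le> r)"
proof
  assume "infnorm x \<le> r"
  then show "\<forall>i. \<bar>x $ i\<bar> \<le> r"
    using component_le_infnorm_cart[of x] order_trans by blast
next
  assume "\<forall>i. \<bar>x $ i\<bar> \<le> r"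
  then show "infnorm x \<le> r"
    unfolding infnorm_cart by (intro cSup_least) auto
qed

lemma mem_cube_infnorm: "x \<in> cube z l \<longleftrightarrow> infnorm (x - z) \<le> l / 2"
  unfolding mem_cube infnorm_cart_le_iff by simp

lemma infnorm_diff_triangle:
  assumes "infnorm (x - y) \<le> a" "infnorm (y - z) \<le> b"
  shows "infnorm (x - z) \<le> a + b"
  using infnorm_triangle[of "x - y" "y - z"] assms by simp

lemma sup_diam_le:
  assumes "\<And>x y. x \<in> E \<Longrightarrow> y \<in> E \<Longrightarrow> infnorm (x - y) \<le> r"
  shows "sup_diam E \<le> ennreal r"
  unfolding sup_diam_def by (intro SUP_least ennreal_leI assms)

lemma infnorm_le_sup_diam:
  assumes "x \<in> E" "y \<in> E" "sup_diam E < \<infinity>"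
  shows "infnorm (x - y) \<le> enn2real (sup_diam E)"
proof -
  have "ennreal (infnorm (x - y)) \<le> sup_diam E"
    unfolding sup_diam_def
    by (rule SUP_upper2[OF assms(1)], rule SUP_upper2[OF assms(2)], rule order_refl)
  also have "\<dots> = ennreal (enn2real (sup_diam E))"
    using assms(3) by (simp add: top.not_eq_extremum)
  finally show ?thesis
    by (simp add: ennreal_le_iff)
qed

text \<open>Families are replaced by sequences with numerical bounds \<open>r i\<close>, so that
  later estimates are series over \<open>nat\<close>. Indices outside the enumeration get the empty
  set and \<open>r i = 0\<close>, at no cost because \<open>0 powr d = 0\<close>.\<close>

lemma hausdorff_content_less_cover:
  assumes "hausdorff_content d E < a"
  obtains F :: "nat \<Rightarrow> (real ^ 'n) set" and r where
    "E \<subseteq> (\<Union>i. F i)" "\<And>i x y. x \<in> F i \<Longrightarrow> y \<in> F i \<Longrightarrow> infnorm (x - y) \<le> r i"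
    "\<And>i. 0 \<le> r i" "(\<Sum>i. ennreal (r i powr d)) < a"
proof -
  obtain \<F> where \<F>: "countable \<F>" "E \<subseteq> \<Union>\<F>" "(SUP F\<in>\<F>. sup_diam F) < \<infinity>"
    and less: "infsum (\<lambda>F. ennreal (enn2real (sup_diam F) powr d)) \<F> < a"
    using assms unfolding hausdorff_content_def INF_less_iff by blast
  define h where "h F = ennreal (enn2real (sup_diam F) powr d)" for F :: "(real ^ 'n) set"
  define ix where "ix = to_nat_on \<F>"
  have inj: "inj_on ix \<F>"
    unfolding ix_def using \<F>(1) by (rule inj_on_to_nat_on)
  define F where "F i = (if i \<in> ix ` \<F> then the_inv_into \<F> ix i else {})" for i
  define r where "r i = (if i \<in> ix ` \<F> then enn2real (sup_diam (F i)) else 0)" for i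
  have F_ix: "F (ix A) = A" if "A \<in> \<F>" for A
    using that inj by (simp add: F_def the_inv_into_f_f)
  have F_in: "F i \<in> \<F>" if "i \<in> ix ` \<F>" for i
    using that F_ix by auto
  have "(\<Sum>i<N. ennreal (r i powr d)) \<le> infsum h \<F>" for N
  proof -
    have "(\<Sum>i<N. ennreal (r i powr d)) = (\<Sum>i\<in>{i. i < N \<and> i \<in> ix ` \<F>}. h (F i))"
      by (intro sum.mono_neutral_cong_right) (auto simp: r_def h_def)
    also have "\<dots> = sum h (F ` {i. i < N \<and> i \<in> ix ` \<F>})"
      by (subst sum.reindex) (auto simp: inj_on_def F_ix)
    also have "\<dots> \<le> infsum h \<F>"
      unfolding nonneg_infsum_complete[OF zero_le]
      using F_in by (intro SUP_upper) auto
    finally show ?thesis .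
  qed
  then have "(\<Sum>i. ennreal (r i powr d)) \<le> infsum h \<F>"
    by (simp add: suminf_eq_SUP SUP_least)
  then have 4: "(\<Sum>i. ennreal (r i powr d)) < a"
    using less unfolding h_def[abs_def] by (rule order_le_less_trans)
  have 1: "E \<subseteq> (\<Union>i. F i)"
  proof
    fix x assume "x \<in> E"
    then obtain A where "A \<in> \<F>" "x \<in> A"
      using \<F>(2) by auto
    then have "x \<in> F (ix A)"
      by (simp add: F_ix)
    then show "x \<in> (\<Union>i. F i)" by blast
  qed
  have 2: "infnorm (x - y) \<le> r i" if "x \<in> F i" "y \<in> F i" for i x y
  proof -
    have i: "i \<in> ix ` \<F>"
      using that by (auto simp: F_def split: if_splits)
    then have "sup_diam (F i) \<le> (SUP F\<in>\<F>. sup_diam F)"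
      using F_in by (intro SUP_upper) auto
    then show ?thesis
      using that \<F>(3) i by (auto simp: r_def intro!: infnorm_le_sup_diam)
  qed
  show thesis
    by (rule that[OF 1 2 _ 4]) (auto simp: r_def)
qed

text \<open>Back from sequences to families: repeated sets count once in \<open>range F\<close>, so
  the sum can only drop, and a finite sum bounds every \<open>r i\<close>, which gives the bounded
  diameters required of a covering.\<close>

lemma hausdorff_content_le_suminf:
  fixes F :: "nat \<Rightarrow> (real ^ 'n) set"
  assumes "d > 0" "E \<subseteq> (\<Union>i. F i)"
    and r: "\<And>i x y. x \<in> F i \<Longrightarrow> y \<in> F i \<Longrightarrow> infnorm (x - y) \<le> r i" "\<And>i. 0 \<le> r i"
  shows "hausdorff_content d E \<le> (\<Sum>i. ennreal (r i powr d))"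
proof (cases "(\<Sum>i. ennreal (r i powr d)) = \<infinity>")
  case False
  define M where "M = enn2real (\<Sum>i. ennreal (r i powr d))"
  have M: "M \<ge> 0" "(\<Sum>i. ennreal (r i powr d)) = ennreal M"
    using False by (simp_all add: M_def less_top)
  have diam: "sup_diam (F i) \<le> ennreal (r i)" for i
    using r(1) by (rule sup_diam_le)
  have diam': "enn2real (sup_diam (F i)) \<le> r i" for i
    using enn2real_mono[OF diam[of i]] r(2)[of i] by simp
  have "r i \<le> M powr (1 / d)" for i
  proof -
    have "ennreal (r i powr d) \<le> ennreal M"
      using sum_le_suminf[of "\<lambda>i. ennreal (r i powr d)" "{i}"] M by simp
    then have "(r i powr d) powr (1 / d) \<le> M powr (1 / d)"
      using M assms by (intro powr_mono2) auto
    then show ?thesis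
      using assms by (simp add: powr_powr)
  qed
  then have "sup_diam (F i) \<le> ennreal (M powr (1 / d))" for i
    using diam[of i] by (meson ennreal_leI order_trans)
  then have "(SUP F\<in>range F. sup_diam F) \<le> ennreal (M powr (1 / d))"
    by (auto intro: SUP_least)
  then have "(SUP F\<in>range F. sup_diam F) < \<infinity>"
    by (rule order_le_less_trans) simp
  then have "hausdorff_content d E \<le> infsum (\<lambda>F. ennreal (enn2real (sup_diam F) powr d)) (range F)"
    unfolding hausdorff_content_def using assms(2) by (intro INF_lower) auto
  also have "\<dots> \<le> (\<Sum>i. ennreal (r i powr d))"
    unfolding nonneg_infsum_complete[OF zero_le]
  proof (intro SUP_least)
    fix G assume "G \<in> {G. finite G \<and> G \<subseteq> range F}"
    then obtain U where U: "inj_on F U" "G = F ` U" "finite U"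
      using subset_image_inj[of G F UNIV] by (auto dest: finite_imageD)
    have "(\<Sum>F\<in>G. ennreal (enn2real (sup_diam F) powr d)) \<le> (\<Sum>i\<in>U. ennreal (r i powr d))"
      using U diam' assms(1) by (auto simp: sum.reindex intro!: sum_mono ennreal_leI powr_mono2)
    also have "\<dots> \<le> (\<Sum>i. ennreal (r i powr d))"
      using U by (intro sum_le_suminf) auto
    finally show "(\<Sum>F\<in>G. ennreal (enn2real (sup_diam F) powr d)) \<le> (\<Sum>i. ennreal (r i powr d))" .
  qed
  finally show ?thesis .
qed simp

lemma hausdorff_content_mono:
  "E \<subseteq> E' \<Longrightarrow> hausdorff_content d E \<le> hausdorff_content d E'"
  unfolding hausdorff_content_def by (intro INF_superset_mono) auto

lemma hausdorff_content_le_powr: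
  assumes "d > 0" "r \<ge> 0" "\<And>x y. x \<in> E \<Longrightarrow> y \<in> E \<Longrightarrow> infnorm (x - y) \<le> r"
  shows "hausdorff_content d E \<le> ennreal (r powr d)"
proof -
  have "hausdorff_content d E
      \<le> (\<Sum>i::nat. ennreal ((if i = 0 then r else 0) powr d))"
    using assms by (intro hausdorff_content_le_suminf[where F = "\<lambda>i. if i = 0 then E else {}"])
      (auto split: if_splits)
  also have "\<dots> = (\<Sum>i\<in>{0::nat}. ennreal ((if i = 0 then r else 0) powr d))"
    by (rule suminf_finite) auto
  finally show ?thesis by simp
qed

text \<open>Outer regularity: the sets of an almost optimal covering are thickened to open sets, so
  thinly that the total cost stays below \<open>a\<close>.\<close>

lemma hausdorff_content_open_nbhd:
  fixes E :: "(real ^ 'n) set"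
  assumes "d > 0" "hausdorff_content d E < a"
  obtains U where "open U" "E \<subseteq> U" "hausdorff_content d U < a"
proof -
  obtain F :: "nat \<Rightarrow> (real ^ 'n) set" and r where F: "E \<subseteq> (\<Union>i. F i)"
      "\<And>i x y. x \<in> F i \<Longrightarrow> y \<in> F i \<Longrightarrow> infnorm (x - y) \<le> r i" "\<And>i. 0 \<le> r i"
      "(\<Sum>i. ennreal (r i powr d)) < a"
    by (rule hausdorff_content_less_cover[OF assms(2)]) (rule that)
  define \<sigma> where "\<sigma> = (\<Sum>i. ennreal (r i powr d))"
  obtain b where b: "\<sigma> < b" "b < a"
    using dense F(4) unfolding \<sigma>_def by blast
  obtain b' where b': "b = ennreal b'" "b' \<ge> 0"
    using b by (cases b rule: ennreal_cases) auto
  obtain s' where s': "\<sigma> = ennreal s'" "s' \<ge> 0"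
    using b by (cases \<sigma> rule: ennreal_cases) auto
  \<comment> \<open>The extra cost \<eta> is shared out as \<open>\<eta> / 2 ^ (i + 1)\<close>, so
    the total is at most \<open>b\<close>, strictly below \<open>a\<close>.\<close>
  define \<eta> where "\<eta> = b' - s'"
  have \<eta>: "\<eta> > 0"
    using b s' b' by (simp add: \<eta>_def ennreal_less_iff)
  have "\<exists>\<delta>>0. (r i + 2 * \<delta>) powr d \<le> r i powr d + \<eta> * (1 / 2) ^ Suc i" for i
  proof -
    have "((\<lambda>\<delta>. (r i + 2 * \<delta>) powr d) \<longlongrightarrow> (r i + 2 * 0) powr d) (at_right 0)"
      using assms(1) F(3)[of i]
      by (intro tendsto_powr' tendsto_intros) (auto simp: eventually_at_filter)
    then have "\<forall>\<^sub>F \<delta> in at_right 0. (r i + 2 * \<delta>) powr d < r i powr d + \<eta> * (1 / 2) ^ Suc i"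
      by (rule order_tendstoD) (use \<eta> in simp)
    moreover have "\<forall>\<^sub>F \<delta> in at_right (0::real). \<delta> > 0"
      by (simp add: eventually_at_right_less)
    ultimately have "\<forall>\<^sub>F \<delta> in at_right 0. \<delta> > 0 \<and> (r i + 2 * \<delta>) powr d < r i powr d + \<eta> * (1 / 2) ^ Suc i"
      by eventually_elim auto
    then show ?thesis
      using eventually_happens'[OF trivial_limit_at_right_real] less_imp_le by blast
  qed
  then obtain \<delta> where \<delta>: "\<And>i. \<delta> i > 0"
      "\<And>i. (r i + 2 * \<delta> i) powr d \<le> r i powr d + \<eta> * (1 / 2) ^ Suc i"
    by metis
  define G where "G i = (\<Union>a\<in>F i. ball a (\<delta> i))" for i
  have "hausdorff_content d (\<Union>i. G i) \<le> (\<Sum>i. ennreal ((r i + 2 * \<delta> i) powr d))"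
  proof (rule hausdorff_content_le_suminf[OF assms(1) subset_refl])
    fix i x y assume "x \<in> G i" "y \<in> G i"
    then obtain a b where ab: "a \<in> F i" "b \<in> F i" "dist a x < \<delta> i" "dist b y < \<delta> i"
      by (auto simp: G_def)
    have "infnorm (x - a) \<le> \<delta> i" "infnorm (b - y) \<le> \<delta> i"
      using ab infnorm_le_norm[of "x - a"] infnorm_le_norm[of "b - y"]
      by (auto simp: dist_norm norm_minus_commute)
    then show "infnorm (x - y) \<le> r i + 2 * \<delta> i"
      using infnorm_diff_triangle[OF infnorm_diff_triangle, of x a "\<delta> i" b "r i" y "\<delta> i"] F(2)[OF ab(1,2)]
      by simp
  next
    show "0 \<le> r i + 2 * \<delta> i" for i
      using F(3)[of i] \<delta>(1)[of i] by simp
  qed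
  also have "\<dots> \<le> (\<Sum>i. ennreal (r i powr d) + ennreal (\<eta> * (1 / 2) ^ Suc i))"
    using \<delta>(2) \<eta> by (intro suminf_le) (auto simp flip: ennreal_plus intro!: ennreal_leI)
  also have "\<dots> = \<sigma> + (\<Sum>i. ennreal (\<eta> * (1 / 2) ^ Suc i))"
    by (simp add: \<sigma>_def suminf_add)
  also have "(\<Sum>i. ennreal (\<eta> * (1 / 2) ^ Suc i)) = ennreal \<eta>"
    using sums_mult[OF power_half_series, of \<eta>] \<eta> by (intro suminf_ennreal_eq) auto
  also have "\<sigma> + ennreal \<eta> = b"
    using s' b' \<eta> by (simp add: \<eta>_def flip: ennreal_plus)
  finally have small: "hausdorff_content d (\<Union>i. G i) < a"
    using b by simp
  have "F i \<subseteq> G i" for i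
    using \<delta>(1)[of i] by (auto simp: G_def)
  then have "(\<Union>i. F i) \<subseteq> (\<Union>i. G i)"
    by (intro UN_mono) auto
  with F(1) have "E \<subseteq> (\<Union>i. G i)"
    by (rule order_trans)
  moreover have "open (\<Union>i. G i)"
    by (auto simp: G_def)
  ultimately show thesis
    using small by (intro that)
qed


section \<open>Thick cubes\<close>

lemma emeasure_cube:
  fixes z :: "real ^ 'n"
  assumes "l \<ge> 0"
  shows "emeasure lborel (cube z l) = ennreal (l ^ CARD('n))"
proof -
  have "z \<in> cube z l"
    using assms by (simp add: mem_cube)
  then have "cbox (\<chi> i. z $ i - l / 2) (\<chi> i. z $ i + l / 2) \<noteq> {}"
    unfolding cube_def by blast
  then have "measure lborel (cube z l) = (\<Prod>i\<in>(UNIV :: 'n set). l)"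
    unfolding cube_def by (subst content_cbox_cart) simp_all
  then show ?thesis
    using emeasure_eq_ennreal_measure[of lborel "cube z l"]
      emeasure_lborel_cbox_finite[of "\<chi> i. z $ i - l / 2" "\<chi> i. z $ i + l / 2"]
    by (simp add: cube_def less_top[symmetric])
qed

lemma cube_borel [measurable]: "cube z l \<in> sets borel"
  unfolding cube_def by simp

lemma subcube_through_point:
  fixes b u v :: "real ^ 'n"
  assumes "b \<in> cbox u v" "r \<ge> 0" "\<And>i. r \<le> v $ i - u $ i"
  obtains z where "b \<in> cube z r" "cube z r \<subseteq> cbox u v"
proof
  \<comment> \<open>In each coordinate the interval of length \<open>r\<close> starts at
    \<open>b $ i\<close>, shifted left just enough not to pass \<open>v $ i\<close>.\<close>
  define z where "z = (\<chi> i. min (b $ i) (v $ i - r) + r / 2)"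
  have b: "u $ i \<le> b $ i" "b $ i \<le> v $ i" for i
    using assms(1) by (auto simp: mem_box_cart)
  show "b \<in> cube z r"
    unfolding mem_cube
  proof
    fix i show "\<bar>b $ i - z $ i\<bar> \<le> r / 2"
      using b[of i] assms(2) by (simp add: z_def min_def abs_if)
  qed
  show "cube z r \<subseteq> cbox u v"
  proof
    fix y assume "y \<in> cube z r"
    then have y: "\<bar>y $ i - z $ i\<bar> \<le> r / 2" for i
      by (simp add: mem_cube)
    have "u $ i \<le> y $ i \<and> y $ i \<le> v $ i" for i
      using b[of i] assms(3)[of i] y[of i]
      by (simp add: z_def min_def abs_le_iff field_simps split: if_splits)
    then show "y \<in> cbox u v"
      by (simp add: mem_box_cart)
  qed
qed

lemma cube_mem_thick_cubes_iff:
  assumes "l > 0"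
  shows "cube z l \<in> thick_cubes S d lam
     \<longleftrightarrow> ennreal (lam * l powr d) \<le> hausdorff_content d (cube z l \<inter> S)"
proof -
  have "is_cube (cube z l)"
    unfolding is_cube_def using assms by blast
  then show ?thesis
    by (simp add: thick_cubes_def side_length_cube[OF assms])
qed

lemma thick_cubesE:
  assumes "Q \<in> thick_cubes S d lam"
  obtains z l where "l > 0" "Q = cube z l" "side_length Q = l"
proof -
  obtain z l where "l > 0" "Q = cube z l"
    using assms unfolding thick_cubes_def is_cube_def by blast
  then show thesis
    using that side_length_cube by blast
qed

definition thick_union :: "(real ^ 'n) set \<Rightarrow> real \<Rightarrow> real \<Rightarrow> real \<Rightarrow> (real ^ 'n) set" where
  "thick_union S d lam s = \<Union>{Q \<in> thick_cubes S d lam. side_length Q < s}"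

lemma mem_thick_union:
  "x \<in> thick_union S d lam s
     \<longleftrightarrow> (\<exists>z l. 0 < l \<and> l < s \<and> cube z l \<in> thick_cubes S d lam \<and> x \<in> cube z l)"
  (is "?L \<longleftrightarrow> ?R")
proof
  assume ?L
  then obtain Q where Q: "Q \<in> thick_cubes S d lam" "side_length Q < s" "x \<in> Q"
    by (auto simp: thick_union_def)
  obtain z l where "l > 0" "Q = cube z l" "side_length Q = l"
    using Q(1) by (rule thick_cubesE)
  with Q show ?R
    by (intro exI[of _ z] exI[of _ l]) simp
next
  assume ?R
  then obtain z l where "0 < l" "l < s" "cube z l \<in> thick_cubes S d lam" "x \<in> cube z l"
    by (elim exE conjE)
  then have "cube z l \<in> {Q \<in> thick_cubes S d lam. side_length Q < s}"
    by (simp add: side_length_cube)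
  with \<open>x \<in> cube z l\<close> show ?L
    unfolding thick_union_def by (rule UnionI[rotated])
qed

lemma thick_union_mono:
  assumes "s \<le> s'"
  shows "thick_union S d lam s \<subseteq> thick_union S d lam s'"
  unfolding thick_union_def
proof (intro Union_mono subsetI)
  fix Q assume "Q \<in> {Q \<in> thick_cubes S d lam. side_length Q < s}"
  then show "Q \<in> {Q \<in> thick_cubes S d lam. side_length Q < s'}"
    using assms by simp
qed

section \<open>The distance to \<open>S\<close> in terms of thick cubes\<close>

lemma hausdorff_content_empty:
  "d > 0 \<Longrightarrow> hausdorff_content d ({} :: (real ^ 'n) set) = 0"
  using hausdorff_content_le_powr[of d 0 "{} :: (real ^ 'n) set"] by (simp add: le_zero_eq)

lemma thick_cube_meets:
  assumes "d > 0" "lam > 0" "Q \<in> thick_cubes S d lam"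
  shows "Q \<inter> S \<noteq> {}"
proof
  assume "Q \<inter> S = {}"
  moreover obtain z l where "l > 0" "Q = cube z l" "side_length Q = l"
    using assms(3) by (rule thick_cubesE)
  ultimately have "ennreal (lam * l powr d) \<le> 0"
    using assms by (simp add: cube_mem_thick_cubes_iff hausdorff_content_empty)
  then show False
    using \<open>l > 0\<close> assms by (simp add: ennreal_eq_0_iff mult_le_0_iff)
qed

text \<open>\<open>Q\<close> contains a point of \<open>S\<close>, so a single step inside
  \<open>Q\<close> leads from \<open>x\<close> to \<open>S\<close>.\<close>

lemma rho_dist_le:
  assumes "d > 0" "lam > 0" "Q \<in> thick_cubes S d lam" "x \<in> Q" "x \<in> E" "x \<notin> S"
  shows "rho_dist S d lam E \<le> ennreal (side_length Q)"
proof -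
  obtain \<xi> where \<xi>: "\<xi> \<in> Q" "\<xi> \<in> S"
    using thick_cube_meets[OF assms(1-3)] by blast
  define p where "p i = (if i = 0 then x else \<xi>)" for i :: nat
  have "rho_dist S d lam E \<le> rho S d lam x \<xi>"
    unfolding rho_dist_def using assms \<xi> by (auto intro: INF_lower2)
  also have "\<dots> \<le> (\<Sum>i<1. rho_step S d lam (p i) (p (Suc i)))"
    unfolding rho_def by (rule INF_lower2[of "(1, p)"]) (auto simp: p_def)
  also have "\<dots> = rho_step S d lam x \<xi>"
    by (simp add: p_def)
  also have "\<dots> \<le> ennreal (side_length Q)"
    unfolding rho_step_def using assms \<xi> by (auto intro!: INF_lower)
  finally show ?thesis .
qed

text \<open>The first nontrivial step of a chain that leaves a point outside \<open>S\<close> already costs the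
  side of a thick cube containing that point.\<close>

lemma rho_dist_ge:
  fixes S :: "(real ^ 'n) set"
  assumes "E \<inter> S = {}" "E \<inter> thick_union S d lam s = {}"
  shows "ennreal s \<le> rho_dist S d lam E"
  unfolding rho_dist_def rho_def
proof (intro INF_greatest)
  fix x \<xi> :: "real ^ 'n" and Np :: "nat \<times> (nat \<Rightarrow> real ^ 'n)"
  assume x: "x \<in> E" and \<xi>: "\<xi> \<in> S" and Np: "Np \<in> {(N, p). p 0 = x \<and> p N = \<xi>}"
  obtain N p where eq: "Np = (N, p)" and p: "p 0 = x" "p N = \<xi>"
    using Np by auto
  have "x \<noteq> \<xi>"
    using x \<xi> assms(1) by blast
  have "p (LEAST i. p i \<noteq> x) \<noteq> x"
    by (rule LeastI[of _ N]) (use p \<open>x \<noteq> \<xi>\<close> in auto)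
  moreover have le: "(LEAST i. p i \<noteq> x) \<le> N"
    by (rule Least_le) (use p \<open>x \<noteq> \<xi>\<close> in auto)
  ultimately obtain i where i: "Suc i = (LEAST i. p i \<noteq> x)" "p (Suc i) \<noteq> x"
    using p(1) by (metis not0_implies_Suc)
  have pi: "p i = x"
    using not_less_Least[of i "\<lambda>i. p i \<noteq> x"] i(1) by auto
  have "ennreal s \<le> rho_step S d lam (p i) (p (Suc i))"
    unfolding rho_step_def pi using i(2) x assms(2)
    by (force simp: thick_union_def intro!: INF_greatest ennreal_leI)
  also have "\<dots> \<le> (\<Sum>i<N. rho_step S d lam (p i) (p (Suc i)))"
    by (rule member_le_sum) (use i le in auto)
  finally show "ennreal s \<le> (case Np of (N, p) \<Rightarrow> \<Sum>i<N. rho_step S d lam (p i) (p (Suc i)))"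
    by (simp add: eq)
qed

section \<open>Limits of thick cubes and Borel measurability\<close>

text \<open>If the limit cube were not thick, some open \<open>U\<close> around its part of
  \<open>S\<close> would have too small a content. The rest of \<open>S\<close> is compact and stays
  away from the limit cube, so late cubes meet \<open>S\<close> only inside \<open>U\<close>. As the
  threshold is continuous in the side, they could not be thick.\<close>

lemma thick_cubes_closed:
  fixes S :: "(real ^ 'n) set"
  assumes "compact S" "d > 0" "z \<longlonglongrightarrow> z'" "l \<longlonglongrightarrow> l'" "l' > 0"
    and "\<And>j. 0 < l j" "\<And>j. cube (z j) (l j) \<in> thick_cubes S d lam"
  shows "cube z' l' \<in> thick_cubes S d lam"
proof (rule ccontr)
  assume "cube z' l' \<notin> thick_cubes S d lam"
  then have less: "hausdorff_content d (cube z' l' \<inter> S) < ennreal (lam * l' powr d)"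
    using assms by (simp add: cube_mem_thick_cubes_iff not_le)
  obtain U where U: "open U" "cube z' l' \<inter> S \<subseteq> U" "hausdorff_content d U < ennreal (lam * l' powr d)"
    by (rule hausdorff_content_open_nbhd[OF assms(2) less])
  \<comment> \<open>The margin \<open>m\<close> is the gap between the limit cube and the compact
    set \<open>S - U\<close>, on which the distance to the center attains its minimum.\<close>
  have "\<exists>m>0. \<forall>x\<in>S - U. l' / 2 + m \<le> infnorm (x - z')"
  proof (cases "S - U = {}")
    case True
    then show ?thesis by (intro exI[of _ 1]) auto
  next
    case False
    have "compact (S - U)"
      using assms(1) U(1) by (rule compact_diff)
    then obtain x0 where x0: "x0 \<in> S - U" "\<And>x. x \<in> S - U \<Longrightarrow> infnorm (x0 - z') \<le> infnorm (x - z')"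
      using continuous_attains_inf[OF _ False, of "\<lambda>x. infnorm (x - z')"]
      by (fastforce intro!: continuous_intros)
    have "x0 \<notin> cube z' l'"
      using x0(1) U(2) by blast
    then have "infnorm (x0 - z') - l' / 2 > 0"
      by (simp add: mem_cube_infnorm)
    then show ?thesis
      using x0(2) by (intro exI[of _ "infnorm (x0 - z') - l' / 2"]) auto
  qed
  then obtain m where m: "m > 0" "\<And>x. x \<in> S - U \<Longrightarrow> l' / 2 + m \<le> infnorm (x - z')"
    by blast
  have "(\<lambda>j. l j / 2 + infnorm (z j - z')) \<longlonglongrightarrow> l' / 2 + infnorm (z' - z')"
    using assms(3,4) by (intro tendsto_intros) auto
  then have "\<forall>\<^sub>F j in sequentially. l j / 2 + infnorm (z j - z') < l' / 2 + m"
    by (rule order_tendstoD) (use m in \<open>simp add: infnorm_0\<close>)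
  moreover have "(\<lambda>j. ennreal (lam * l j powr d)) \<longlonglongrightarrow> ennreal (lam * l' powr d)"
    using assms by (intro tendsto_intros) auto
  then have "\<forall>\<^sub>F j in sequentially. hausdorff_content d U < ennreal (lam * l j powr d)"
    by (rule order_tendstoD) (rule U(3))
  ultimately have "\<forall>\<^sub>F j in sequentially. False"
  proof eventually_elim
    case (elim j)
    have "cube (z j) (l j) \<inter> S \<subseteq> U"
    proof
      fix x assume x: "x \<in> cube (z j) (l j) \<inter> S"
      then have "infnorm (x - z') \<le> l j / 2 + infnorm (z j - z')"
        using infnorm_diff_triangle[of x "z j" "l j / 2" z'] by (auto simp: mem_cube_infnorm)
      then show "x \<in> U"
        using m(2)[of x] x elim(1) by fastforce
    qed
    then have "ennreal (lam * l j powr d) \<le> hausdorff_content d U"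
      using assms(6,7)[of j] hausdorff_content_mono order_trans
      by (simp add: cube_mem_thick_cubes_iff) blast
    with elim(2) show False by simp
  qed
  then show False by simp
qed

text \<open>Sides are confined to \<open>[1 / (m + 1), s - 1 / (m + 1)]\<close>, so that neither the
  degenerate side 0 nor the excluded side \<open>s\<close> arises in a limit. By compactness for
  centers and sides each \<open>V m\<close> is closed, and these sets exhaust the union.\<close>

lemma thick_union_borel:
  fixes S :: "(real ^ 'n) set"
  assumes "compact S" "d > 0"
  shows "thick_union S d lam s \<in> sets borel"
proof -
  define V where "V m = {x. \<exists>z l. 1 / Suc m \<le> l \<and> l \<le> s - 1 / Suc m \<and>
    cube z l \<in> thick_cubes S d lam \<and> x \<in> cube z l}" for m
  have "closed (V m)" for m
    unfolding closed_sequential_limits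
  proof (intro allI impI)
    fix x x' assume "(\<forall>j. x j \<in> V m) \<and> x \<longlonglongrightarrow> x'"
    then have xV: "\<And>j. x j \<in> V m" and lim: "x \<longlonglongrightarrow> x'"
      by auto
    have "\<forall>j. \<exists>zl. 1 / Suc m \<le> snd zl \<and> snd zl \<le> s - 1 / Suc m \<and>
        cube (fst zl) (snd zl) \<in> thick_cubes S d lam \<and> x j \<in> cube (fst zl) (snd zl)"
      using xV by (force simp: V_def)
    then obtain g where g: "\<And>j. 1 / Suc m \<le> snd (g j)" "\<And>j. snd (g j) \<le> s - 1 / Suc m"
        "\<And>j. cube (fst (g j)) (snd (g j)) \<in> thick_cubes S d lam"
        "\<And>j. x j \<in> cube (fst (g j)) (snd (g j))"
      by metis
    obtain B where B: "\<And>j. norm (x j) \<le> B"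
      using convergent_imp_Bseq[of x] lim by (auto simp: convergent_def Bseq_def)
    \<comment> \<open>Each center is within \<open>s / 2\<close> of the bounded sequence
      \<open>x j\<close> in the maximum norm; passing to the Euclidean norm costs the root of the
      dimension.\<close>
    define B' where "B' = B + sqrt (DIM(real ^ 'n)) * (s / 2)"
    have "norm (fst (g j)) \<le> B'" for j
    proof -
      have "infnorm (fst (g j) - x j) \<le> s / 2"
        using g(1,2,4)[of j] divide_nonneg_nonneg[of 1 "real (Suc m)"]
        unfolding mem_cube_infnorm by (subst infnorm_sub) linarith
      then have "sqrt (DIM(real ^ 'n)) * infnorm (fst (g j) - x j) \<le> sqrt (DIM(real ^ 'n)) * (s / 2)"
        by (intro mult_left_mono) auto
      with norm_le_infnorm[of "fst (g j) - x j"]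
      have "norm (fst (g j) - x j) \<le> sqrt (DIM(real ^ 'n)) * (s / 2)"
        by (rule order_trans)
      then show ?thesis
        using B[of j] norm_triangle_ineq[of "fst (g j) - x j" "x j"] by (simp add: B'_def)
    qed
    then have g_in: "\<forall>j. g j \<in> cball 0 B' \<times> {1 / Suc m..s - 1 / Suc m}"
      using g by (auto simp: mem_Times_iff)
    have "seq_compact (cball (0 :: real ^ 'n) B' \<times> {1 / real (Suc m)..s - 1 / real (Suc m)})"
      by (intro compact_imp_seq_compact compact_Times) auto
    then obtain zl \<sigma> where zl: "zl \<in> cball (0 :: real ^ 'n) B' \<times> {1 / real (Suc m)..s - 1 / real (Suc m)}"
        "strict_mono \<sigma>" "(g \<circ> \<sigma>) \<longlonglongrightarrow> zl"
      using g_in by (rule seq_compactE) blast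
    obtain z l where [simp]: "zl = (z, l)" by fastforce
    have l: "1 / Suc m \<le> l" "l \<le> s - 1 / Suc m"
      using zl(1) by auto
    have pos: "0 < 1 / real (Suc m)" by simp
    have lims: "(\<lambda>j. fst (g (\<sigma> j))) \<longlonglongrightarrow> z" "(\<lambda>j. snd (g (\<sigma> j))) \<longlonglongrightarrow> l"
      using tendsto_fst[OF zl(3)] tendsto_snd[OF zl(3)] by (auto simp: o_def)
    have "cube z l \<in> thick_cubes S d lam"
    proof (rule thick_cubes_closed[OF assms lims])
      show "0 < l" "\<And>j. 0 < snd (g (\<sigma> j))"
        using l(1) g(1) pos less_le_trans by blast+
    qed (rule g)
    moreover have "x' \<in> cube z l"
    proof -
      have "(\<lambda>j. x (\<sigma> j)) \<longlonglongrightarrow> x'"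
        using LIMSEQ_subseq_LIMSEQ[OF lim zl(2)] by (simp add: o_def)
      then have "(\<lambda>j. infnorm (x (\<sigma> j) - fst (g (\<sigma> j)))) \<longlonglongrightarrow> infnorm (x' - z)"
        using lims by (intro tendsto_intros)
      moreover have "(\<lambda>j. snd (g (\<sigma> j)) / 2) \<longlonglongrightarrow> l / 2"
        using lims by (intro tendsto_intros) auto
      ultimately show ?thesis
        unfolding mem_cube_infnorm
        by (rule LIMSEQ_le) (use g(4) in \<open>auto simp: mem_cube_infnorm\<close>)
    qed
    ultimately show "x' \<in> V m"
      using l unfolding V_def by blast
  qed
  then have "(\<Union>m. V m) \<in> sets borel"
    by (intro sets.countable_UN) auto
  moreover have "thick_union S d lam s = (\<Union>m. V m)"
  proof (intro equalityI subsetI)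
    fix x assume "x \<in> thick_union S d lam s"
    then obtain z l where zl: "0 < l" "l < s" "cube z l \<in> thick_cubes S d lam" "x \<in> cube z l"
      by (auto simp: mem_thick_union)
    obtain m where m: "1 / Suc m < min l (s - l)"
      using reals_Archimedean[of "min l (s - l)"] zl by (auto simp: inverse_eq_divide)
    then have "x \<in> V m"
      using zl unfolding V_def by (intro CollectI exI[of _ z] exI[of _ l]) auto
    then show "x \<in> (\<Union>m. V m)" by blast
  next
    fix x assume "x \<in> (\<Union>m. V m)"
    then obtain m z l where "1 / Suc m \<le> l" "l \<le> s - 1 / Suc m" "cube z l \<in> thick_cubes S d lam" "x \<in> cube z l"
      by (auto simp: V_def)
    moreover have "0 < 1 / real (Suc m)" by simp
    ultimately have "0 < l" "l < s" by linarith+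
    with \<open>cube z l \<in> thick_cubes S d lam\<close> \<open>x \<in> cube z l\<close> show "x \<in> thick_union S d lam s"
      unfolding mem_thick_union by blast
  qed
  ultimately show ?thesis by simp
qed


section \<open>Volume of small thick cubes\<close>

text \<open>Continuity of the measure from below along an enumeration of \<open>C\<close>.\<close>

lemma emeasure_UN_le_if_finite:
  assumes "countable C" "\<And>j. j \<in> C \<Longrightarrow> X j \<in> sets M"
    and "\<And>J. finite J \<Longrightarrow> J \<subseteq> C \<Longrightarrow> emeasure M (\<Union>j\<in>J. X j) \<le> c"
  shows "emeasure M (\<Union>j\<in>C. X j) \<le> c"
proof (cases "C = {}")
  case False
  define f where "f = from_nat_into C"
  have f: "range f = C"
    unfolding f_def using assms(1) False by (simp add: range_from_nat_into)
  define A where "A N = (\<Union>j\<in>f ` {..<N}. X j)" for N :: nat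
  have fC: "f i \<in> C" for i
    using f by blast
  have UN: "(\<Union>j\<in>C. X j) = (\<Union>N. A N)"
  proof -
    have "(\<Union>N. A N) = (\<Union>i. X (f i))"
      by (auto simp: A_def)
    then show ?thesis
      by (simp flip: f)
  qed
  have "incseq A"
    unfolding A_def incseq_def by (intro allI impI UN_mono image_mono) auto
  moreover have "range A \<subseteq> sets M"
    using assms(2) fC by (auto simp: A_def intro!: sets.finite_UN)
  ultimately have "(SUP N. emeasure M (A N)) = emeasure M (\<Union>N. A N)"
    by (rule SUP_emeasure_incseq[rotated])
  then have "emeasure M (\<Union>N. A N) = (SUP N. emeasure M (A N))"
    by simp
  also have "\<dots> \<le> c"
    unfolding A_def using fC by (intro SUP_least assms(3)) auto
  finally show ?thesis
    by (simp only: UN)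
qed (use assms(3)[of "{}"] in simp)

text \<open>Each of the cubes contains a cube of side exactly \<open>r\<close> through a point of
  \<open>F\<close>. These smaller cubes are disjoint and stay within \<open>2 * r\<close> of a fixed
  point of \<open>F\<close>, hence in a cube of side \<open>4 * r\<close>; volumes are
  compared.\<close>

lemma card_disjoint_cubes_meeting:
  fixes F :: "(real ^ 'n) set"
  assumes "finite J" "pairwise (\<lambda>i j. disjnt (cube (w i) (l i)) (cube (w j) (l j))) J"
    and "r > 0" "\<And>x y. x \<in> F \<Longrightarrow> y \<in> F \<Longrightarrow> infnorm (x - y) \<le> r"
    and "\<And>j. j \<in> J \<Longrightarrow> r \<le> l j" "\<And>j. j \<in> J \<Longrightarrow> F \<inter> cube (w j) (l j) \<noteq> {}"
  shows "real (card J) \<le> 4 ^ CARD('n)"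
proof (cases "J = {}")
  case False
  then obtain a where a: "a \<in> F"
    using assms(6) by blast
  have "\<forall>j\<in>J. \<exists>v. cube v r \<subseteq> cube (w j) (l j) \<and> cube v r \<subseteq> cube a (4 * r)"
  proof
    fix j assume j: "j \<in> J"
    obtain b where b: "b \<in> F" "b \<in> cube (w j) (l j)"
      using assms(6)[OF j] by blast
    obtain v where v: "b \<in> cube v r" "cube v r \<subseteq> cube (w j) (l j)"
      unfolding cube_def
      by (rule subcube_through_point[OF b(2)[unfolded cube_def], of r])
        (use assms(3) assms(5)[OF j] in \<open>auto simp: cube_def\<close>)
    have "cube v r \<subseteq> cube a (4 * r)"
    proof
      fix y assume "y \<in> cube v r"
      then have "infnorm (y - b) \<le> r / 2 + r / 2"
        using v(1) infnorm_sub[of b v] by (intro infnorm_diff_triangle[of y v]) (auto simp: mem_cube_infnorm)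
      from infnorm_diff_triangle[OF this assms(4)[OF b(1) a]] show "y \<in> cube a (4 * r)"
        by (simp add: mem_cube_infnorm)
    qed
    with v(2) show "\<exists>v. cube v r \<subseteq> cube (w j) (l j) \<and> cube v r \<subseteq> cube a (4 * r)" by blast
  qed
  then obtain v where v: "\<And>j. j \<in> J \<Longrightarrow> cube (v j) r \<subseteq> cube (w j) (l j)"
      "\<And>j. j \<in> J \<Longrightarrow> cube (v j) r \<subseteq> cube a (4 * r)"
    by metis
  have "disjoint_family_on (\<lambda>j. cube (v j) r) J"
    unfolding disjoint_family_on_def
  proof (intro ballI impI)
    fix i j assume "i \<in> J" "j \<in> J" "i \<noteq> j"
    then have "cube (w i) (l i) \<inter> cube (w j) (l j) = {}"
      using assms(2) by (auto simp: pairwise_def disjnt_def)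
    then show "cube (v i) r \<inter> cube (v j) r = {}"
      using v(1)[OF \<open>i \<in> J\<close>] v(1)[OF \<open>j \<in> J\<close>] by blast
  qed
  then have "(\<Sum>j\<in>J. emeasure lborel (cube (v j) r)) = emeasure lborel (\<Union>j\<in>J. cube (v j) r)"
    using assms(1) by (intro sum_emeasure) auto
  also have "\<dots> \<le> emeasure lborel (cube a (4 * r))"
    using v(2) by (intro emeasure_mono UN_least) auto
  finally have "of_nat (card J) * ennreal (r ^ CARD('n)) \<le> ennreal ((4 * r) ^ CARD('n))"
    using assms(3) by (simp add: emeasure_cube)
  then have "ennreal (real (card J) * r ^ CARD('n)) \<le> ennreal ((4 * r) ^ CARD('n))"
    using assms(3) by (simp add: ennreal_mult ennreal_of_nat_eq_real_of_nat)
  then have "real (card J) * r ^ CARD('n) \<le> 4 ^ CARD('n) * r ^ CARD('n)"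
    using assms(3) by (simp add: power_mult_distrib)
  then show ?thesis
    using assms(3) by simp
qed simp

text \<open>This turns content sums into volumes: the factor \<open>x powr (n - d)\<close> is
  bounded by the scale \<open>y\<close>, where \<open>d < n\<close> enters, and
  \<open>x powr d\<close> is left for summation.\<close>

lemma power_le_powr_mult:
  assumes "0 \<le> x" "x \<le> y" "0 < d" "d < real n"
  shows "x ^ n \<le> y powr (real n - d) * x powr d"
proof (cases "x = 0")
  case False
  then have "x ^ n = x powr (real n - d) * x powr d"
    using assms by (simp flip: powr_add powr_realpow)
  also have "\<dots> \<le> y powr (real n - d) * x powr d"
    using assms by (intro mult_right_mono powr_mono2) auto
  finally show ?thesis .
qed (use assms in \<open>auto simp: power_0_left\<close>)

text \<open>A member of the covering meets at most \<open>4 ^ n\<close> of the disjoint cubes, because its diameter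
  is at most the side of each cube it meets.\<close>

lemma sum_disjoint_thick_cubes_le:
  fixes F :: "nat \<Rightarrow> (real ^ 'n) set"
  assumes d: "d > 0" and lam: "lam > 0" and J: "finite J"
      "pairwise (\<lambda>i j. disjnt (cube (w i) (l i)) (cube (w j) (l j))) J"
    and thick: "\<And>j. j \<in> J \<Longrightarrow> l j > 0" "\<And>j. j \<in> J \<Longrightarrow> cube (w j) (l j) \<in> thick_cubes S d lam"
    and F: "\<And>j. j \<in> J \<Longrightarrow> cube (w j) (l j) \<inter> S \<subseteq> (\<Union>i. F i)"
      "\<And>i x y. x \<in> F i \<Longrightarrow> y \<in> F i \<Longrightarrow> infnorm (x - y) \<le> r i" "\<And>i. 0 \<le> r i"
    and small: "\<And>i j. j \<in> J \<Longrightarrow> F i \<inter> cube (w j) (l j) \<noteq> {} \<Longrightarrow> r i \<le> l j"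
    and m: "(\<Sum>i. ennreal (r i powr d)) \<le> ennreal (lam * m)" "m \<ge> 0"
  shows "(\<Sum>j\<in>J. l j powr d) \<le> 4 ^ CARD('n) * m"
proof -
  \<comment> \<open>The covering is adapted to cube \<open>j\<close>: sets that miss it get radius
    0. After the sums are exchanged, the set \<open>F i\<close> is counted once for every cube it
    meets.\<close>
  define \<rho> where "\<rho> i j = (if F i \<inter> cube (w j) (l j) = {} then 0 else r i)" for i j
  have "ennreal (lam * l j powr d) \<le> (\<Sum>i. ennreal (\<rho> i j powr d))" if j: "j \<in> J" for j
  proof -
    have "ennreal (lam * l j powr d) \<le> hausdorff_content d (cube (w j) (l j) \<inter> S)"
      using thick[OF j] by (simp add: cube_mem_thick_cubes_iff)
    also have "\<dots> \<le> (\<Sum>i. ennreal (\<rho> i j powr d))"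
    proof (rule hausdorff_content_le_suminf[OF d, where F = "\<lambda>i. F i \<inter> cube (w j) (l j)"])
      show "cube (w j) (l j) \<inter> S \<subseteq> (\<Union>i. F i \<inter> cube (w j) (l j))"
        using F(1)[OF j] by auto
      show "infnorm (x - y) \<le> \<rho> i j"
        if "x \<in> F i \<inter> cube (w j) (l j)" "y \<in> F i \<inter> cube (w j) (l j)" for i x y
        using that F(2)[of x i y] by (auto simp: \<rho>_def)
    qed (use F(3) in \<open>simp add: \<rho>_def\<close>)
    finally show ?thesis .
  qed
  then have "(\<Sum>j\<in>J. ennreal (lam * l j powr d)) \<le> (\<Sum>j\<in>J. \<Sum>i. ennreal (\<rho> i j powr d))"
    by (rule sum_mono)
  also have "\<dots> = (\<Sum>i. \<Sum>j\<in>J. ennreal (\<rho> i j powr d))"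
    by (rule suminf_sum[symmetric]) simp
  also have "\<dots> \<le> (\<Sum>i. ennreal (4 ^ CARD('n)) * ennreal (r i powr d))"
  proof (rule suminf_le)
    fix i
    define J' where "J' = {j \<in> J. F i \<inter> cube (w j) (l j) \<noteq> {}}"
    have "(\<Sum>j\<in>J. ennreal (\<rho> i j powr d)) = (\<Sum>j\<in>J'. ennreal (r i powr d))"
      using J(1) by (intro sum.mono_neutral_cong_right) (auto simp: J'_def \<rho>_def)
    also have "\<dots> = ennreal (real (card J')) * ennreal (r i powr d)"
      by (simp add: ennreal_of_nat_eq_real_of_nat)
    also have "\<dots> \<le> ennreal (4 ^ CARD('n)) * ennreal (r i powr d)"
    \<comment> \<open>Counting cubes by volume needs a positive radius; sets with
      \<open>r i = 0\<close> contribute \<open>0 powr d = 0\<close>.\<close>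
    proof (cases "r i = 0")
      case False
      have "real (card J') \<le> 4 ^ CARD('n)"
      proof (rule card_disjoint_cubes_meeting)
        show "finite J'" "0 < r i"
          using J(1) False F(3)[of i] by (auto simp: J'_def)
        show "pairwise (\<lambda>i j. disjnt (cube (w i) (l i)) (cube (w j) (l j))) J'"
          by (rule pairwise_subset[OF J(2)]) (auto simp: J'_def)
        show "infnorm (x - y) \<le> r i" if "x \<in> F i" "y \<in> F i" for x y
          by (rule F(2)[OF that])
        show "r i \<le> l j" "F i \<inter> cube (w j) (l j) \<noteq> {}" if "j \<in> J'" for j
          using that small by (auto simp: J'_def)
      qed
      then show ?thesis
        by (intro mult_right_mono ennreal_leI) auto
    qed simp
    finally show "(\<Sum>j\<in>J. ennreal (\<rho> i j powr d)) \<le> ennreal (4 ^ CARD('n)) * ennreal (r i powr d)" .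
  qed simp_all
  also have "\<dots> = ennreal (4 ^ CARD('n)) * (\<Sum>i. ennreal (r i powr d))"
    by simp
  also have "\<dots> \<le> ennreal (4 ^ CARD('n)) * ennreal (lam * m)"
    using m(1) by (rule mult_left_mono) simp
  also have "\<dots> = ennreal (4 ^ CARD('n) * (lam * m))"
    using lam m(2) by (simp add: ennreal_mult)
  finally have "ennreal (\<Sum>j\<in>J. lam * l j powr d) \<le> ennreal (4 ^ CARD('n) * (lam * m))"
    using lam by simp
  then have "(\<Sum>j\<in>J. lam * l j powr d) \<le> 4 ^ CARD('n) * (lam * m)"
    using lam m(2) by (subst (asm) ennreal_le_iff) auto
  then have "lam * (\<Sum>j\<in>J. l j powr d) \<le> lam * (4 ^ CARD('n) * m)"
    by (simp add: sum_distrib_left mult_ac)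
  then show ?thesis
    using lam by simp
qed

section \<open>The volume left free in a cube that is not thick\<close>

lemma cube_subset_cball: "cube w l \<subseteq> cball w (real CARD('n) * (l / 2))" for w :: "real ^ 'n"
proof
  fix x assume x: "x \<in> cube w l"
  have "norm (x - w) \<le> (\<Sum>i\<in>UNIV. \<bar>(x - w) $ i\<bar>)"
    by (rule norm_le_l1_cart)
  also have "\<dots> \<le> (\<Sum>i\<in>(UNIV :: 'n set). l / 2)"
    using x by (intro sum_mono) (simp add: mem_cube)
  finally show "x \<in> cball w (real CARD('n) * (l / 2))"
    by (simp add: dist_norm norm_minus_commute)
qed

lemma cball_subset_cube: "cball w s \<subseteq> cube w (2 * s)"
proof
  fix x assume "x \<in> cball w s"
  then show "x \<in> cube w (2 * s)"
    using infnorm_le_norm[of "x - w"] by (simp add: mem_cube_infnorm dist_norm norm_minus_commute)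
qed

text \<open>Vitali's covering lemma selects countably many cubes whose enclosing balls are disjoint
  and whose fivefold balls cover all cubes in question. For the selected ones the sum of
  \<open>l powr d\<close> is at most \<open>4 ^ n * t powr d\<close> by packing; as all sides are at
  most \<open>eps * t\<close>, the volume of the enlarged cubes carries the small factor
  \<open>eps powr (n - d)\<close>.\<close>

lemma thick_cubes_not_below_cover_small:
  fixes F :: "nat \<Rightarrow> (real ^ 'n) set"
  assumes d: "0 < d" "d < real CARD('n)" and lam: "lam > 0" and t: "t > 0" and eps: "eps > 0"
      "(5 * real CARD('n)) ^ CARD('n) * 4 ^ CARD('n) * eps powr (real CARD('n) - d) \<le> 1 / 10"
    and F: "cube z t \<inter> S \<subseteq> (\<Union>i. F i)"
      "\<And>i x y. x \<in> F i \<Longrightarrow> y \<in> F i \<Longrightarrow> infnorm (x - y) \<le> r i" "\<And>i. 0 \<le> r i"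
      "(\<Sum>i. ennreal (r i powr d)) \<le> ennreal (lam * t powr d)"
  obtains V where "V \<in> sets borel" "emeasure lborel V \<le> ennreal (t ^ CARD('n) / 10)"
    "\<And>w l. 0 < l \<Longrightarrow> l \<le> eps * t \<Longrightarrow> cube w l \<in> thick_cubes S d lam \<Longrightarrow> cube w l \<subseteq> cube z t \<Longrightarrow>
       \<forall>i. F i \<inter> cube w l \<noteq> {} \<longrightarrow> r i \<le> l \<Longrightarrow> cube w l \<subseteq> V"
proof -
  define n where "n = CARD('n)"
  have n: "n \<ge> 1" by (simp add: n_def Suc_leI)
  define K where "K = {(w, l). 0 < l \<and> l \<le> eps * t \<and> cube w l \<in> thick_cubes S d lam \<and>
    cube w l \<subseteq> cube z t \<and> (\<forall>i. F i \<inter> cube w l \<noteq> {} \<longrightarrow> r i \<le> l)}"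
  have K: "0 < snd p" "snd p \<le> eps * t" "cube (fst p) (snd p) \<in> thick_cubes S d lam"
      "cube (fst p) (snd p) \<subseteq> cube z t" "\<And>i. F i \<inter> cube (fst p) (snd p) \<noteq> {} \<Longrightarrow> r i \<le> snd p"
    if "p \<in> K" for p
    using that by (simp_all add: K_def split_beta)
  have rad: "\<And>p. p \<in> K \<Longrightarrow> 0 < real n * (snd p / 2) \<and> real n * (snd p / 2) \<le> real n * (eps * t / 2)"
    using K n by (auto simp: mult_left_mono)
  obtain C where C: "countable C" "C \<subseteq> K"
      "pairwise (\<lambda>p q. disjnt (cball (fst p) (real n * (snd p / 2))) (cball (fst q) (real n * (snd q / 2)))) C"
      "(\<Union>p\<in>K. cball (fst p) (real n * (snd p / 2))) \<subseteq> (\<Union>p\<in>C. cball (fst p) (5 * (real n * (snd p / 2))))"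
    by (rule Vitali_covering_lemma_cballs[OF order_refl, of K "\<lambda>p. real n * (snd p / 2)" _ fst, OF rad])
      (assumption, rule that)
  \<comment> \<open>The fivefold ball has radius \<open>5 * n * l / 2\<close> for a cube of side
    \<open>l\<close>, so it fits into a cube of side \<open>5 * n * l\<close>.\<close>
  define X where "X p = cube (fst p) (5 * real n * snd p)" for p :: "(real ^ 'n) \<times> real"
  show thesis
  proof (rule that[of "\<Union>p\<in>C. X p"])
    show "(\<Union>p\<in>C. X p) \<in> sets borel"
      using C(1) by (intro sets.countable_UN') (auto simp: X_def)
    show "emeasure lborel (\<Union>p\<in>C. X p) \<le> ennreal (t ^ CARD('n) / 10)"
    proof (rule emeasure_UN_le_if_finite[OF C(1)])
      fix J assume J: "finite J" "J \<subseteq> C"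
      have JK: "p \<in> K" if "p \<in> J" for p
        using that J C(2) by blast
      have sum: "(\<Sum>p\<in>J. snd p powr d) \<le> 4 ^ CARD('n) * t powr d"
      proof (rule sum_disjoint_thick_cubes_le[OF d(1) lam J(1), where w = fst and F = F and r = r])
        show "pairwise (\<lambda>p q. disjnt (cube (fst p) (snd p)) (cube (fst q) (snd q))) J"
        proof (rule pairwise_mono[OF C(3) _ J(2)])
          fix p q :: "(real ^ 'n) \<times> real"
          assume "disjnt (cball (fst p) (real n * (snd p / 2))) (cball (fst q) (real n * (snd q / 2)))"
          then show "disjnt (cube (fst p) (snd p)) (cube (fst q) (snd q))"
            unfolding n_def by (meson cube_subset_cball disjnt_subset1 disjnt_subset2)
        qed
        show "cube (fst p) (snd p) \<inter> S \<subseteq> (\<Union>i. F i)" if "p \<in> J" for p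
          using K(4)[OF JK[OF that]] F(1) by blast
      qed (use K JK F in auto)
      have "emeasure lborel (\<Union>p\<in>J. X p) \<le> (\<Sum>p\<in>J. emeasure lborel (X p))"
        using J(1) by (intro emeasure_subadditive_finite) (auto simp: X_def)
      also have "\<dots> = (\<Sum>p\<in>J. ennreal ((5 * real n * snd p) ^ n))"
        using K(1) JK by (intro sum.cong) (auto simp: X_def emeasure_cube n_def less_imp_le)
      also have "\<dots> = ennreal (\<Sum>p\<in>J. (5 * real n * snd p) ^ n)"
        using K(1) JK by (intro sum_ennreal) (auto simp: less_imp_le)
      also have "\<dots> \<le> ennreal (t ^ CARD('n) / 10)"
      proof (rule ennreal_leI)
        have "(\<Sum>p\<in>J. (5 * real n * snd p) ^ n)
            \<le> (\<Sum>p\<in>J. (5 * real n) ^ n * ((eps * t) powr (real n - d) * snd p powr d))"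
          unfolding power_mult_distrib[of "5 * real n"]
          using K(1,2) JK d by (intro sum_mono mult_left_mono power_le_powr_mult) (auto simp: n_def less_imp_le)
        also have "\<dots> = (5 * real n) ^ n * (eps * t) powr (real n - d) * (\<Sum>p\<in>J. snd p powr d)"
          by (simp add: mult.assoc flip: sum_distrib_left)
        also have "\<dots> \<le> (5 * real n) ^ n * (eps * t) powr (real n - d) * (4 ^ n * t powr d)"
          using sum by (intro mult_left_mono) (auto simp: n_def)
        also have "\<dots> = ((5 * real n) ^ n * 4 ^ n * eps powr (real n - d)) * (t powr (real n - d) * t powr d)"
          using t eps by (simp add: powr_mult mult_ac)
        also have "t powr (real n - d) * t powr d = t ^ n"
          using t by (simp flip: powr_add powr_realpow)
        also have "((5 * real n) ^ n * 4 ^ n * eps powr (real n - d)) * t ^ n \<le> 1 / 10 * t ^ n"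
          using eps(2) t by (intro mult_right_mono) (auto simp: n_def)
        finally show "(\<Sum>p\<in>J. (5 * real n * snd p) ^ n) \<le> t ^ CARD('n) / 10"
          by (simp add: n_def)
      qed
      finally show "emeasure lborel (\<Union>p\<in>J. X p) \<le> ennreal (t ^ CARD('n) / 10)" .
    qed (simp add: X_def)
    fix w l assume "0 < l" "l \<le> eps * t" "cube w l \<in> thick_cubes S d lam" "cube w l \<subseteq> cube z t"
       "\<forall>i. F i \<inter> cube w l \<noteq> {} \<longrightarrow> r i \<le> l"
    then have "(w, l) \<in> K"
      by (simp add: K_def)
    then have 1: "cball w (real n * (l / 2)) \<subseteq> (\<Union>p\<in>K. cball (fst p) (real n * (snd p / 2)))"
      by force
    have 2: "cube w l \<subseteq> cball w (real n * (l / 2))"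
      unfolding n_def by (rule cube_subset_cball)
    have 3: "(\<Union>p\<in>C. cball (fst p) (5 * (real n * (snd p / 2)))) \<subseteq> (\<Union>p\<in>C. X p)"
    proof (intro UN_mono order_refl)
      fix p :: "(real ^ 'n) \<times> real"
      show "cball (fst p) (5 * (real n * (snd p / 2))) \<subseteq> X p"
        using cball_subset_cube[of "fst p" "5 * (real n * (snd p / 2))"] by (simp add: X_def mult_ac)
    qed
    show "cube w l \<subseteq> (\<Union>p\<in>C. X p)"
      by (rule order_trans[OF 2 order_trans[OF 1 order_trans[OF C(4) 3]]])
  qed
qed

text \<open>In a cube that is not thick, the set \<open>S\<close> and the small thick cubes occupy at most the
  proportion \<open>4 / 5\<close> of the volume. Fix an almost optimal covering of the part of \<open>S\<close> inside. Thick
  cubes that meet a larger member of the covering lie in a dilate of it, and so does \<open>S\<close>; these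
  dilates have small volume as \<open>lam \<le> 6 ^ -n\<close>. The other small thick cubes have small total
  volume because \<open>d < n\<close>.\<close>

lemma small_thick_cubes_cover:
  fixes S :: "(real ^ 'n) set"
  assumes d: "0 < d" "d < real CARD('n)" and lam: "lam > 0" "lam \<le> (1 / 6) ^ CARD('n)"
    and t: "t > 0" and eps: "eps > 0"
      "(5 * real CARD('n)) ^ CARD('n) * 4 ^ CARD('n) * eps powr (real CARD('n) - d) \<le> 1 / 10"
    and thin: "hausdorff_content d (cube z t \<inter> S) < ennreal (lam * t powr d)"
  obtains V where "V \<in> sets borel" "emeasure lborel V \<le> ennreal (4 / 5 * t ^ CARD('n))"
    "cube z t \<inter> S \<subseteq> V"
    "\<And>w l. 0 < l \<Longrightarrow> l \<le> eps * t \<Longrightarrow> cube w l \<in> thick_cubes S d lam \<Longrightarrow> cube w l \<subseteq> cube z t \<Longrightarrow>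
       cube w l \<subseteq> V"
proof -
  define n where "n = CARD('n)"
  have n: "n \<ge> 1" by (simp add: n_def Suc_leI)
  obtain F r where F: "cube z t \<inter> S \<subseteq> (\<Union>i :: nat. F i)"
      "\<And>i x y. x \<in> F i \<Longrightarrow> y \<in> F i \<Longrightarrow> infnorm (x - y) \<le> r i" "\<And>i. 0 \<le> r i"
      "(\<Sum>i. ennreal (r i powr d)) < ennreal (lam * t powr d)"
    by (rule hausdorff_content_less_cover[OF thin]) (rule that)
  obtain V2 where V2: "V2 \<in> sets borel" "emeasure lborel V2 \<le> ennreal (t ^ CARD('n) / 10)"
      "\<And>w l. 0 < l \<Longrightarrow> l \<le> eps * t \<Longrightarrow> cube w l \<in> thick_cubes S d lam \<Longrightarrow> cube w l \<subseteq> cube z t \<Longrightarrow>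
         \<forall>i. F i \<inter> cube w l \<noteq> {} \<longrightarrow> r i \<le> l \<Longrightarrow> cube w l \<subseteq> V2"
    by (rule thick_cubes_not_below_cover_small[OF d lam(1) t eps F(1) _ F(3) less_imp_le[OF F(4)]])
      (rule F(2), assumption, assumption, rule that)
  have "lam \<le> 1"
    using lam(2) power_le_one[of "1 / 6 :: real" "CARD('n)"] by simp
  \<comment> \<open>A member with \<open>r i > t\<close> would alone cost at least
    \<open>t powr d\<close>, which reaches the threshold because \<open>lam \<le> 1\<close>.\<close>
  have r_le: "r i \<le> t" for i
  proof (rule ccontr)
    assume "\<not> r i \<le> t"
    then have "t powr d \<le> r i powr d"
      using t d by (intro powr_mono2) auto
    moreover have "lam * t powr d \<le> t powr d"
      using \<open>lam \<le> 1\<close> lam(1) by (intro mult_left_le_one_le) auto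
    ultimately have "ennreal (lam * t powr d) \<le> ennreal (r i powr d)"
      by (intro ennreal_leI) linarith
    also have "\<dots> = (\<Sum>i\<in>{i}. ennreal (r i powr d))"
      by simp
    also have "\<dots> \<le> (\<Sum>i. ennreal (r i powr d))"
      by (rule sum_le_suminf) simp_all
    finally show False
      using F(4) by (rule leD[THEN notE])
  qed
  \<comment> \<open>An anchor in each member of the covering. For an empty member it is arbitrary,
    and the cube around it is still paid for by \<open>r i\<close>.\<close>
  define a where "a i = (SOME a. a \<in> F i)" for i
  have F_dist: "infnorm (x - a i) \<le> r i" if "x \<in> F i" for x i
    using F(2)[OF that] someI[of "\<lambda>a. a \<in> F i" x] that by (simp add: a_def)
  \<comment> \<open>A cube of side below \<open>r i\<close> that meets \<open>F i\<close> has all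
    its points within \<open>2 * r i\<close> of the anchor, whence the side
    \<open>4 * r i\<close>.\<close>
  define V1 where "V1 = (\<Union>i. cube (a i) (4 * r i))"
  have "emeasure lborel V1 \<le> (\<Sum>i. emeasure lborel (cube (a i) (4 * r i)))"
    unfolding V1_def by (rule emeasure_subadditive_countably) auto
  also have "\<dots> = (\<Sum>i. ennreal ((4 * r i) ^ n))"
    using F(3) by (simp add: emeasure_cube n_def)
  also have "\<dots> \<le> (\<Sum>i. ennreal (4 ^ n * t powr (real n - d)) * ennreal (r i powr d))"
  proof (rule suminf_le)
    fix i
    have "(4 * r i) ^ n \<le> 4 ^ n * (t powr (real n - d) * r i powr d)"
      unfolding power_mult_distrib using d F(3) r_le
      by (intro mult_left_mono power_le_powr_mult) (auto simp: n_def)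
    then show "ennreal ((4 * r i) ^ n) \<le> ennreal (4 ^ n * t powr (real n - d)) * ennreal (r i powr d)"
      by (simp add: mult.assoc ennreal_leI flip: ennreal_mult)
  qed simp_all
  also have "\<dots> = ennreal (4 ^ n * t powr (real n - d)) * (\<Sum>i. ennreal (r i powr d))"
    by simp
  also have "\<dots> \<le> ennreal (4 ^ n * t powr (real n - d)) * ennreal (lam * t powr d)"
    using F(4) by (intro mult_left_mono) auto
  also have "\<dots> = ennreal (4 ^ n * lam * (t powr (real n - d) * t powr d))"
    using lam by (simp add: mult_ac flip: ennreal_mult)
  also have "t powr (real n - d) * t powr d = t ^ n"
    using t by (simp flip: powr_add powr_realpow)
  \<comment> \<open>Here the bound on \<open>lam\<close> enters: \<open>4 ^ n * lam\<close> is at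
    most \<open>(4 / 6) ^ n\<close>, hence at most \<open>2 / 3\<close>.\<close>
  also have "ennreal (4 ^ n * lam * t ^ n) \<le> ennreal (2 / 3 * t ^ n)"
  proof (intro ennreal_leI mult_right_mono)
    have "4 ^ n * lam \<le> 4 ^ n * (1 / 6) ^ n"
      using lam by (intro mult_left_mono) (auto simp: n_def)
    also have "\<dots> = (2 / 3) ^ n"
      by (simp flip: power_mult_distrib)
    also have "\<dots> \<le> (2 / 3) ^ 1"
      using n by (intro power_decreasing) auto
    finally show "4 ^ n * lam \<le> 2 / 3" by simp
  qed (use t in simp)
  finally have V1: "emeasure lborel V1 \<le> ennreal (2 / 3 * t ^ n)" .
  have V1_borel: "V1 \<in> sets borel"
    unfolding V1_def by (intro sets.countable_UN) auto
  show thesis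
  proof (rule that[of "V1 \<union> V2"])
    show "V1 \<union> V2 \<in> sets borel"
      using V1_borel V2(1) by simp
    have "emeasure lborel (V1 \<union> V2) \<le> emeasure lborel V1 + emeasure lborel V2"
      using V1_borel V2(1) by (intro emeasure_subadditive) auto
    also have "\<dots> \<le> ennreal (2 / 3 * t ^ n) + ennreal (t ^ n / 10)"
      using V1 V2(2) unfolding n_def by (rule add_mono)
    also have "\<dots> = ennreal (2 / 3 * t ^ n + t ^ n / 10)"
      using t by (simp flip: ennreal_plus)
    also have "\<dots> \<le> ennreal (4 / 5 * t ^ n)"
      using t by (intro ennreal_leI) simp
    finally show "emeasure lborel (V1 \<union> V2) \<le> ennreal (4 / 5 * t ^ CARD('n))"
      by (simp add: n_def)
    show "cube z t \<inter> S \<subseteq> V1 \<union> V2"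
    proof
      fix x assume "x \<in> cube z t \<inter> S"
      then obtain i where "x \<in> F i"
        using F(1) by blast
      then have "x \<in> cube (a i) (4 * r i)"
        using F_dist[of x i] F(3)[of i] by (simp add: mem_cube_infnorm)
      then show "x \<in> V1 \<union> V2"
        by (auto simp: V1_def)
    qed
    fix w l assume w: "0 < l" "l \<le> eps * t" "cube w l \<in> thick_cubes S d lam" "cube w l \<subseteq> cube z t"
    show "cube w l \<subseteq> V1 \<union> V2"
    proof (cases "\<forall>i. F i \<inter> cube w l \<noteq> {} \<longrightarrow> r i \<le> l")
      case True
      then have "cube w l \<subseteq> V2"
        by (rule V2(3)[OF w])
      then show ?thesis by blast
    next
      case False
      then obtain i b where i: "b \<in> F i" "b \<in> cube w l" "l < r i"
        by (auto simp: not_le)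
      have "cube w l \<subseteq> cube (a i) (4 * r i)"
      proof
        fix x assume "x \<in> cube w l"
        then have "infnorm (x - b) \<le> l / 2 + l / 2"
          using i(2) infnorm_sub[of b w] by (intro infnorm_diff_triangle[of x w]) (auto simp: mem_cube_infnorm)
        from infnorm_diff_triangle[OF this F_dist[OF i(1)]]
        show "x \<in> cube (a i) (4 * r i)"
          using i(3) by (simp add: mem_cube_infnorm)
      qed
      then show ?thesis
        by (auto simp: V1_def)
    qed
  qed
qed

text \<open>The inner cube \<open>I\<close> leaves a margin \<open>eps * t\<close> on every side, so
  a thick cube of side below \<open>eps * t\<close> that meets \<open>I\<close> stays inside
  \<open>cube z t\<close> and is covered by \<open>V\<close>. By Bernoulli's inequality
  \<open>I\<close> keeps \<open>9 / 10\<close> of the volume, of which \<open>V\<close> takes at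
  most \<open>4 / 5\<close> of the whole.\<close>

lemma not_thick_cube_good_part:
  fixes S :: "(real ^ 'n) set"
  assumes d: "0 < d" "d < real CARD('n)" and lam: "lam > 0" "lam \<le> (1 / 6) ^ CARD('n)"
    and t: "t > 0" and eps: "eps > 0" "eps \<le> 1 / (20 * real CARD('n))"
      "(5 * real CARD('n)) ^ CARD('n) * 4 ^ CARD('n) * eps powr (real CARD('n) - d) \<le> 1 / 10"
    and thin: "cube z t \<notin> thick_cubes S d lam"
  obtains G where "G \<in> sets borel" "G \<subseteq> interior (cube z t)" "G \<inter> S = {}"
    "G \<inter> thick_union S d lam (eps * t) = {}" "ennreal (t ^ CARD('n) / 10) \<le> emeasure lborel G"
proof -
  define n where "n = CARD('n)"
  have n: "n \<ge> 1" by (simp add: n_def Suc_leI)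
  have "hausdorff_content d (cube z t \<inter> S) < ennreal (lam * t powr d)"
    using thin t by (simp add: cube_mem_thick_cubes_iff not_le)
  then obtain V where V: "V \<in> sets borel" "emeasure lborel V \<le> ennreal (4 / 5 * t ^ CARD('n))"
    "cube z t \<inter> S \<subseteq> V"
    "\<And>w l. 0 < l \<Longrightarrow> l \<le> eps * t \<Longrightarrow> cube w l \<in> thick_cubes S d lam \<Longrightarrow> cube w l \<subseteq> cube z t \<Longrightarrow>
       cube w l \<subseteq> V"
    by (rule small_thick_cubes_cover[OF d lam t eps(1,3)]) (rule that)
  define I where "I = cube z ((1 - 2 * eps) * t)"
  have neps: "real n * (2 * eps) \<le> 1 / 10"
  proof -
    have "real n * (2 * eps) \<le> real n * (2 * (1 / (20 * real n)))"
      using eps(2) by (intro mult_left_mono) (auto simp: n_def)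
    then show ?thesis
      using n by simp
  qed
  have eps1: "2 * eps \<le> 1 / 10"
  proof -
    have "1 * (2 * eps) \<le> real n * (2 * eps)"
      using n eps(1) by (intro mult_right_mono) auto
    then show ?thesis
      using neps by linarith
  qed
  have I_sub: "I \<subseteq> interior (cube z t)"
  proof
    fix y assume "y \<in> I"
    then have "\<bar>y $ i - z $ i\<bar> \<le> t / 2 - eps * t" for i
      by (simp add: I_def mem_cube algebra_simps diff_divide_distrib)
    moreover have "0 < eps * t"
      using eps t by simp
    ultimately have "z $ i - t / 2 < y $ i \<and> y $ i < z $ i + t / 2" for i
      by (smt (verit))
    then show "y \<in> interior (cube z t)"
      by (simp add: cube_def interior_cbox mem_box_cart)
  qed
  show thesis
  proof (rule that[of "I - V"])
    show "I - V \<in> sets borel"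
      using V(1) by (auto simp: I_def)
    show "I - V \<subseteq> interior (cube z t)"
      using I_sub by blast
    show "(I - V) \<inter> S = {}"
      using I_sub interior_subset[of "cube z t"] V(3) by blast
    show "(I - V) \<inter> thick_union S d lam (eps * t) = {}"
    proof (rule ccontr)
      assume "(I - V) \<inter> thick_union S d lam (eps * t) \<noteq> {}"
      then obtain y where y: "y \<in> I" "y \<notin> V" "y \<in> thick_union S d lam (eps * t)"
        by blast
      then obtain w l where w: "0 < l" "l < eps * t" "cube w l \<in> thick_cubes S d lam" "y \<in> cube w l"
        unfolding mem_thick_union by (elim exE conjE)
      have "cube w l \<subseteq> cube z t"
      proof
        fix x assume "x \<in> cube w l"
        then have "infnorm (x - y) \<le> l / 2 + l / 2"
          using w(4) infnorm_sub[of y w] by (intro infnorm_diff_triangle[of x w]) (auto simp: mem_cube_infnorm)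
        moreover have "infnorm (y - z) \<le> (1 - 2 * eps) * t / 2"
          using y(1) by (simp add: I_def mem_cube_infnorm)
        ultimately have "infnorm (x - z) \<le> (l / 2 + l / 2) + (1 - 2 * eps) * t / 2"
          by (rule infnorm_diff_triangle)
        then show "x \<in> cube z t"
          using w(2) by (simp add: mem_cube_infnorm field_simps)
      qed
      with V(4)[OF w(1) less_imp_le[OF w(2)] w(3)] y(2) w(4) show False
        by auto
    qed
    have "ennreal (4 / 5 * t ^ n) + ennreal (t ^ n / 10) = ennreal (9 / 10 * t ^ n)"
      using t by (simp flip: ennreal_plus)
    also have "\<dots> \<le> ennreal (((1 - 2 * eps) * t) ^ n)"
    proof (rule ennreal_leI)
      have "1 + real n * (- (2 * eps)) \<le> (1 + - (2 * eps)) ^ n"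
        using eps1 by (intro Bernoulli_inequality) linarith
      then have "9 / 10 \<le> (1 - 2 * eps) ^ n"
        using neps by simp
      then show "9 / 10 * t ^ n \<le> ((1 - 2 * eps) * t) ^ n"
        unfolding power_mult_distrib using t by (intro mult_right_mono) auto
    qed
    also have "\<dots> = emeasure lborel I"
      using t eps1 by (simp add: I_def emeasure_cube n_def)
    also have "\<dots> \<le> emeasure lborel (V \<union> (I - V))"
      using V(1) by (intro emeasure_mono) (auto simp: I_def)
    also have "\<dots> \<le> emeasure lborel V + emeasure lborel (I - V)"
      using V(1) by (intro emeasure_subadditive) (auto simp: I_def)
    also have "\<dots> \<le> ennreal (4 / 5 * t ^ n) + emeasure lborel (I - V)"
      using V(2) unfolding n_def by (rule add_right_mono)
    finally show "ennreal (t ^ CARD('n) / 10) \<le> emeasure lborel (I - V)"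
      by (simp add: ennreal_add_left_cancel_le n_def)
  qed
qed

text \<open>A thick cube through \<open>x\<close> meets \<open>S\<close>, hence its intersection with the dilated unit cube is a
  box with all sides at least \<open>min l ((c - 1) / 2)\<close>.\<close>

lemma good_part_near_point:
  fixes S :: "(real ^ 'n) set"
  assumes d: "0 < d" "d < real CARD('n)" and lam: "lam > 0" "lam \<le> (1 / 6) ^ CARD('n)"
    and eps: "eps > 0" "eps \<le> 1 / (20 * real CARD('n))"
      "(5 * real CARD('n)) ^ CARD('n) * 4 ^ CARD('n) * eps powr (real CARD('n) - d) \<le> 1 / 10"
    and c: "c > 1" and S: "S \<subseteq> cube q 1" and s: "0 < s" "s \<le> c"
    and x: "x \<in> cube q c" "x \<in> thick_union S d lam (2 * s)" "x \<notin> thick_union S d lam s"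
    and t: "t = (c - 1) / (2 * c) * s"
  obtains G where "G \<in> sets borel" "G \<subseteq> interior (cube q c) \<inter> cube x (2 * t) - S"
    "G \<subseteq> thick_union S d lam (2 * s) - thick_union S d lam (eps * t)"
    "ennreal (t ^ CARD('n) / 10) \<le> emeasure lborel G"
proof -
  obtain w l where w: "0 < l" "l < 2 * s" "cube w l \<in> thick_cubes S d lam" "x \<in> cube w l"
    using x(2) unfolding mem_thick_union by (elim exE conjE)
  have "s \<le> l"
  proof (rule ccontr)
    assume "\<not> s \<le> l"
    then have "x \<in> thick_union S d lam s"
      unfolding mem_thick_union using w by (intro exI[of _ w] exI[of _ l]) simp
    with x(3) show False by blast
  qed
  \<comment> \<open>The ratio serves two ends: it is below 1, so \<open>t < s\<close>, and with
    \<open>s \<le> c\<close> it gives \<open>t \<le> (c - 1) / 2\<close>, the distance from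
    \<open>cube q 1\<close> to the boundary of \<open>cube q c\<close>.\<close>
  have \<kappa>: "0 < (c - 1) / (2 * c)" "(c - 1) / (2 * c) < 1"
    using c by (auto simp: field_simps)
  have "t > 0"
    unfolding t using \<kappa> s by (intro mult_pos_pos)
  have "t < s"
    unfolding t using mult_strict_right_mono[OF \<kappa>(2) s(1)] by (simp only: mult_1_left)
  have "t \<le> (c - 1) / (2 * c) * c"
    unfolding t using \<kappa> s by (intro mult_left_mono) auto
  then have "t \<le> (c - 1) / 2"
    using c by simp
  obtain \<xi> where \<xi>: "\<xi> \<in> cube w l" "\<xi> \<in> S"
    using thick_cube_meets[OF d(1) lam(1) w(3)] by blast
  then have \<xi>q: "\<xi> \<in> cube q 1"
    using S by blast
  define u v where "u = (\<chi> i. max (w $ i - l / 2) (q $ i - c / 2))"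
    and "v = (\<chi> i. min (w $ i + l / 2) (q $ i + c / 2))"
  have uv: "cbox u v = cube w l \<inter> cube q c"
    by (auto simp: cube_def u_def v_def mem_box_cart)
  \<comment> \<open>When the two ends come from different cubes, \<xi> separates them: it lies in
    \<open>cube w l\<close> and is at least \<open>(c - 1) / 2\<close> away from the faces of
    \<open>cube q c\<close>.\<close>
  have "t \<le> v $ i - u $ i" for i
  proof -
    have "\<bar>\<xi> $ i - w $ i\<bar> \<le> l / 2" "\<bar>\<xi> $ i - q $ i\<bar> \<le> 1 / 2"
      using \<xi>(1) \<xi>q by (auto simp: mem_cube)
    then show ?thesis
      using \<open>t < s\<close> \<open>s \<le> l\<close> \<open>t \<le> (c - 1) / 2\<close> c
      unfolding u_def v_def vec_lambda_beta min_def max_def abs_le_iff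
      by (simp split: if_split)
  qed
  then obtain z where z: "x \<in> cube z t" "cube z t \<subseteq> cube w l \<inter> cube q c"
    using subcube_through_point[of x u v t] x(1) w(4) \<open>t > 0\<close> unfolding uv by (metis IntI less_imp_le)
  have "cube z t \<notin> thick_cubes S d lam"
  proof
    assume "cube z t \<in> thick_cubes S d lam"
    then have "x \<in> thick_union S d lam s"
      unfolding mem_thick_union using z(1) \<open>t > 0\<close> \<open>t < s\<close> by (intro exI[of _ z] exI[of _ t]) simp
    with x(3) show False by blast
  qed
  then obtain G where G: "G \<in> sets borel" "G \<subseteq> interior (cube z t)" "G \<inter> S = {}"
    "G \<inter> thick_union S d lam (eps * t) = {}" "ennreal (t ^ CARD('n) / 10) \<le> emeasure lborel G"
    by (rule not_thick_cube_good_part[OF d lam \<open>t > 0\<close> eps]) (rule that)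
  have G_sub: "G \<subseteq> cube z t"
    using G(2) interior_subset by (rule order_trans)
  have "cube z t \<subseteq> cube x (2 * t)"
  proof
    fix y assume "y \<in> cube z t"
    then have "infnorm (y - x) \<le> t / 2 + t / 2"
      using z(1) infnorm_sub[of x z] by (intro infnorm_diff_triangle[of y z]) (auto simp: mem_cube_infnorm)
    then show "y \<in> cube x (2 * t)"
      by (simp add: mem_cube_infnorm)
  qed
  with G_sub have Gx: "G \<subseteq> cube x (2 * t)"
    by (rule order_trans)
  have "interior (cube z t) \<subseteq> interior (cube q c)"
    using z(2) by (intro interior_mono) simp
  with G(2) have Gq: "G \<subseteq> interior (cube q c)"
    by (rule order_trans)
  have "cube w l \<subseteq> thick_union S d lam (2 * s)"
  proof
    fix y assume "y \<in> cube w l"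
    then show "y \<in> thick_union S d lam (2 * s)"
      unfolding mem_thick_union using w by (intro exI[of _ w] exI[of _ l]) simp
  qed
  moreover have "G \<subseteq> cube w l"
    using G_sub z(2) by auto
  ultimately have "G \<subseteq> thick_union S d lam (2 * s)"
    by simp
  with G Gx Gq show thesis
    by (intro that[of G]) auto
qed

section \<open>The decomposition\<close>

text \<open>Everything is compared with \<open>s\<close>. The diameter is at most
  \<open>4 * s\<close> by the enclosing cube and at least \<open>k * s / 20\<close> by the volume of
  \<open>G\<close>; the distance lies between \<open>e * s\<close> and \<open>2 * s\<close> by the
  conditions on thick cubes. The quotients of these bounds are \<open>4 / e\<close> and
  \<open>40 / k\<close>.\<close>

lemma comparable_piece:
  fixes S :: "(real ^ 'n) set"
  assumes d: "d > 0" and lam: "lam > 0" and s: "s > 0" and k: "0 < k" "0 < e"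
    and \<Omega>: "\<Omega> \<in> sets borel" "\<Omega> \<subseteq> cube b (4 * s)" "\<Omega> \<inter> S = {}"
      "\<Omega> \<subseteq> thick_union S d lam (2 * s)" "\<Omega> \<inter> thick_union S d lam (e * s) = {}"
    and G: "G \<subseteq> \<Omega>" "ennreal ((k * s) ^ CARD('n) / 10) \<le> emeasure lborel G"
    and C: "4 / e \<le> C" "40 / k \<le> C"
  shows "ennreal (1 / C) * sup_diam \<Omega> \<le> rho_dist S d lam \<Omega>"
    and "rho_dist S d lam \<Omega> \<le> ennreal C * sup_diam \<Omega>"
    and "ennreal (k ^ CARD('n) / (10 * 4 ^ CARD('n))) * sup_diam \<Omega> ^ CARD('n) \<le> emeasure lborel \<Omega>"
proof -
  define n where "n = CARD('n)"
  have n: "n \<ge> 1" by (simp add: n_def Suc_leI)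
  have "C > 0"
    using C(1) k(2) by (smt (verit) divide_pos_pos)
  have diam_le: "sup_diam \<Omega> \<le> ennreal (4 * s)"
  proof (rule sup_diam_le)
    fix x y assume "x \<in> \<Omega>" "y \<in> \<Omega>"
    then have "infnorm (x - b) \<le> 2 * s" "infnorm (y - b) \<le> 2 * s"
      using \<Omega>(2) by (auto simp: mem_cube_infnorm)
    then show "infnorm (x - y) \<le> 4 * s"
      using infnorm_diff_triangle[of x b "2 * s" y "2 * s"] infnorm_sub[of b y] by simp
  qed
  define r where "r = enn2real (sup_diam \<Omega>)"
  have fin: "sup_diam \<Omega> < \<infinity>"
    using diam_le by (rule order_le_less_trans) simp
  have diam: "sup_diam \<Omega> = ennreal r" "r \<ge> 0"
    using fin by (simp_all add: r_def less_top)
  have r_le: "r \<le> 4 * s"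
    using diam diam_le s by simp
  have mG: "ennreal ((k * s) ^ n / 10) \<le> emeasure lborel \<Omega>"
    using G(2) emeasure_mono[OF G(1), of lborel] \<Omega>(1) unfolding n_def by (auto intro: order_trans)
  have pos: "(k * s) ^ n / 10 > 0"
    using k s by simp
  have "\<Omega> \<noteq> {}"
    using mG pos by (auto simp: ennreal_eq_0_iff)
  then obtain a where a: "a \<in> \<Omega>" by blast
  \<comment> \<open>A set of diameter \<open>r\<close> lies in a cube of side \<open>2 * r\<close>
    about any of its points. For smaller \<open>r\<close> its volume would be below
    \<open>(k * s / 10) ^ n\<close>, which is at most \<open>(k * s) ^ n / 10\<close>.\<close>
  have r_ge: "k * s / 20 \<le> r"
  proof (rule ccontr)
    assume "\<not> k * s / 20 \<le> r"
    then have "2 * r < k * s / 10" by simp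
    have "\<Omega> \<subseteq> cube a (2 * r)"
      using infnorm_le_sup_diam[OF _ a fin] by (auto simp: mem_cube_infnorm r_def)
    then have "emeasure lborel \<Omega> \<le> emeasure lborel (cube a (2 * r))"
      by (intro emeasure_mono) auto
    also have "\<dots> = ennreal ((2 * r) ^ n)"
      using diam(2) by (simp add: emeasure_cube n_def)
    finally have "ennreal ((k * s) ^ n / 10) \<le> ennreal ((2 * r) ^ n)"
      by (rule order_trans[OF mG])
    then have "(k * s) ^ n / 10 \<le> (2 * r) ^ n"
      using diam(2) by simp
    also have "\<dots> < (k * s / 10) ^ n"
      using \<open>2 * r < k * s / 10\<close> diam(2) n by (intro power_strict_mono) auto
    also have "\<dots> \<le> (k * s) ^ n / 10"
    proof -
      have "(10 :: real) ^ 1 \<le> 10 ^ n"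
        using n by (intro power_increasing) auto
      then have "(k * s) ^ n / 10 ^ n \<le> (k * s) ^ n / 10 ^ 1"
        using k s by (intro divide_left_mono) auto
      then show ?thesis
        by (simp add: power_divide)
    qed
    finally show False by simp
  qed
  show "ennreal (1 / C) * sup_diam \<Omega> \<le> rho_dist S d lam \<Omega>"
  proof -
    have "1 / C * r \<le> e / 4 * (4 * s)"
      using C(1) k(2) \<open>C > 0\<close> r_le diam(2) by (intro mult_mono) (auto simp: field_simps)
    then have "ennreal (1 / C * r) \<le> ennreal (e * s)"
      by (intro ennreal_leI) simp
    also have "\<dots> \<le> rho_dist S d lam \<Omega>"
      by (rule rho_dist_ge[OF \<Omega>(3,5)])
    finally show ?thesis
      using \<open>C > 0\<close> diam by (simp flip: ennreal_mult)
  qed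
  show "rho_dist S d lam \<Omega> \<le> ennreal C * sup_diam \<Omega>"
  proof -
    have "a \<in> thick_union S d lam (2 * s)"
      using a \<Omega>(4) by blast
    then obtain w l where w: "0 < l" "l < 2 * s" "cube w l \<in> thick_cubes S d lam" "a \<in> cube w l"
      unfolding mem_thick_union by (elim exE conjE)
    have "a \<notin> S"
      using a \<Omega>(3) by blast
    have "rho_dist S d lam \<Omega> \<le> ennreal l"
      using rho_dist_le[OF d lam w(3,4) a \<open>a \<notin> S\<close>] w(1) by (simp add: side_length_cube)
    also have "\<dots> \<le> ennreal (C * r)"
    proof (rule ennreal_leI)
      have "2 * s = 40 / k * (k * s / 20)"
        using k by simp
      also have "\<dots> \<le> C * r"
        using C(2) r_ge \<open>C > 0\<close> k s by (intro mult_mono) auto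
      finally show "l \<le> C * r"
        using w(2) by simp
    qed
    finally show ?thesis
      using \<open>C > 0\<close> diam by (simp add: ennreal_mult)
  qed
  have "k ^ n / (10 * 4 ^ n) * r ^ n \<le> k ^ n / (10 * 4 ^ n) * (4 * s) ^ n"
    using k r_le diam(2) by (intro mult_left_mono power_mono) auto
  also have "\<dots> = (k * s) ^ n / 10"
    by (simp add: power_mult_distrib)
  finally have "ennreal (k ^ n / (10 * 4 ^ n) * r ^ n) \<le> emeasure lborel \<Omega>"
    using mG by (meson ennreal_leI order_trans)
  then show "ennreal (k ^ CARD('n) / (10 * 4 ^ CARD('n))) * sup_diam \<Omega> ^ CARD('n) \<le> emeasure lborel \<Omega>"
    using k diam by (simp add: n_def ennreal_power flip: ennreal_mult)
qed

section \<open>Choice of the scale, counting, and constants\<close>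

text \<open>A thick cube through \<open>x\<close> reaches \<open>S\<close>, so its side is bounded
  below in terms of the Euclidean distance from \<open>x\<close> to \<open>S\<close>; the factor
  \<open>n\<close> converts between the norms.\<close>

lemma not_in_small_thick_union:
  fixes S :: "(real ^ 'n) set"
  assumes "closed S" "x \<notin> S" "d > 0" "lam > 0"
  obtains \<eta> where "\<eta> > 0" "x \<notin> thick_union S d lam \<eta>"
proof -
  obtain \<delta> where \<delta>: "\<delta> > 0" "ball x \<delta> \<inter> S = {}"
    using assms(1,2) by (metis ComplI closed_def disjoint_eq_subset_Compl openE)
  have "x \<notin> thick_union S d lam (\<delta> / real CARD('n))"
  proof
    assume "x \<in> thick_union S d lam (\<delta> / real CARD('n))"
    then obtain w l where w: "0 < l" "l < \<delta> / real CARD('n)" "cube w l \<in> thick_cubes S d lam" "x \<in> cube w l"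
      unfolding mem_thick_union by (elim exE conjE)
    obtain \<xi> where \<xi>: "\<xi> \<in> cube w l" "\<xi> \<in> S"
      using thick_cube_meets[OF assms(3,4) w(3)] by blast
    have "infnorm (\<xi> - x) \<le> l / 2 + l / 2"
      using \<xi>(1) w(4) infnorm_sub[of x w] by (intro infnorm_diff_triangle[of \<xi> w]) (auto simp: mem_cube_infnorm)
    then have "\<xi> \<in> cball x (real CARD('n) * l)"
      using cube_subset_cball[of x "2 * l"] by (auto simp: mem_cube_infnorm)
    moreover have "real CARD('n) * l < \<delta>"
      using w(2) by (simp add: field_simps)
    ultimately have "\<xi> \<in> ball x \<delta>"
      by simp
    with \<delta>(2) \<xi>(2) show False by blast
  qed
  with \<delta>(1) show thesis
    by (intro that[of "\<delta> / real CARD('n)"]) auto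
qed

text \<open>\<open>k\<close> is the first level at which \<open>P\<close> fails, which exists
  because \<open>P\<close> fails at \<eta>. The preceding level gives the other half, or the
  assumption at \<open>2 * c\<close> if \<open>k = 0\<close>.\<close>

lemma exists_dyadic_level:
  fixes c \<eta> :: real
  assumes "P (2 * c)" "\<not> P \<eta>" "\<eta> > 0" "\<And>s s'. s \<le> s' \<Longrightarrow> P s \<Longrightarrow> P s'"
  obtains k :: nat where "P (2 * (c / 2 ^ k))" "\<not> P (c / 2 ^ k)"
proof -
  have "\<exists>k. \<not> P (c / 2 ^ k)"
  proof -
    obtain k :: nat where "c / \<eta> < 2 ^ k"
      using real_arch_pow[of 2 "c / \<eta>"] by auto
    then have "c / 2 ^ k \<le> \<eta>"
      using assms(3) by (simp add: field_simps)
    then show ?thesis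
      using assms(2,4) by blast
  qed
  define k where "k = (LEAST k. \<not> P (c / 2 ^ k))"
  have k: "\<not> P (c / 2 ^ k)"
    unfolding k_def by (rule LeastI_ex) fact
  have "P (2 * (c / 2 ^ k))"
  proof (cases k)
    case 0
    then show ?thesis using assms(1) by simp
  next
    case (Suc j)
    then have "P (c / 2 ^ j)"
      using not_less_Least[of j "\<lambda>k. \<not> P (c / 2 ^ k)"] by (simp add: k_def)
    then show ?thesis
      by (simp add: Suc)
  qed
  then show thesis
    using k by (rule that)
qed

text \<open>Used to count pieces through a point: each coordinate of the index has five possible
  values, whence the factor \<open>5 ^ CARD('n)\<close>.\<close>

lemma floor_grid_offset:
  fixes y s :: real
  assumes "s > 0" "\<bar>y - s * of_int m\<bar> \<le> 2 * s"
  shows "m - \<lfloor>y / s\<rfloor> \<in> {-2..2}"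
proof -
  have "\<bar>(y - s * of_int m) / s\<bar> \<le> 2"
    using assms by (simp add: abs_divide divide_le_eq)
  then have "\<bar>y / s - of_int m\<bar> \<le> 2"
    using assms(1) by (simp add: diff_divide_distrib)
  then show ?thesis
    by (simp add: abs_le_iff) linarith
qed

text \<open>The content of \<open>S\<close> is at most 1, since \<open>S\<close> has diameter at
  most 1. Dropping \<open>c powr d\<close> then gives the smallness needed for volumes, and dropping
  the power of 6 makes the dilated unit cube thick.\<close>

lemma lam_bounds:
  fixes S :: "(real ^ 'n) set"
  assumes "0 < d" "c > 1" "lam > 0" "S \<subseteq> cube q 1"
    and "ennreal lam < hausdorff_content d S / ennreal (c powr d * 6 ^ CARD('n))"
  shows "lam \<le> (1 / 6) ^ CARD('n)" and "ennreal (lam * c powr d) \<le> hausdorff_content d S"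
proof -
  have "infnorm (x - y) \<le> 1" if "x \<in> S" "y \<in> S" for x y
  proof -
    have "infnorm (x - q) \<le> 1 / 2" "infnorm (y - q) \<le> 1 / 2"
      using that assms(4) by (auto simp: mem_cube_infnorm)
    then show ?thesis
      using infnorm_diff_triangle[of x q "1 / 2" y "1 / 2"] infnorm_sub[of q y] by simp
  qed
  then have "hausdorff_content d S \<le> ennreal (1 powr d)"
    using assms(1) by (intro hausdorff_content_le_powr) auto
  then have le1: "hausdorff_content d S \<le> 1"
    by simp
  define h where "h = enn2real (hausdorff_content d S)"
  have h: "hausdorff_content d S = ennreal h" "0 \<le> h" "h \<le> 1"
    using le1 order_le_less_trans[OF le1 ennreal_one_less_top] by (simp_all add: h_def enn2real_leI)
  have cd: "1 \<le> c powr d"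
    using assms(1,2) by (intro ge_one_powr_ge_zero) auto
  have six: "1 \<le> (6 :: real) ^ CARD('n)"
    by simp
  have pos: "0 < c powr d * 6 ^ CARD('n)"
    using assms(2) by simp
  have "ennreal lam < ennreal (h / (c powr d * 6 ^ CARD('n)))"
    using assms(5) h pos by (simp add: divide_ennreal)
  then have "lam < h / (c powr d * 6 ^ CARD('n))"
    using assms(3) by (simp add: ennreal_less_iff)
  then have main: "lam * (c powr d * 6 ^ CARD('n)) < h"
    using pos by (simp add: pos_less_divide_eq)
  have "lam * (1 * 6 ^ CARD('n)) \<le> lam * (c powr d * 6 ^ CARD('n))"
    using assms(3) cd by (intro mult_left_mono mult_right_mono) auto
  then have "lam * 6 ^ CARD('n) \<le> 1"
    using main h by simp
  then show "lam \<le> (1 / 6) ^ CARD('n)"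
    by (simp add: power_divide field_simps)
  have "lam * (c powr d * 1) \<le> lam * (c powr d * 6 ^ CARD('n))"
    using assms(2,3) six by (intro mult_left_mono) auto
  then show "ennreal (lam * c powr d) \<le> hausdorff_content d S"
    using main h by (simp add: ennreal_leI)
qed

lemma nat_subset_interval_if_diff_less:
  fixes K :: "nat set"
  assumes "\<And>k k'. k \<in> K \<Longrightarrow> k' \<in> K \<Longrightarrow> k < k' \<Longrightarrow> k' - k < L"
  obtains k0 where "K \<subseteq> {k0..<k0 + Suc L}"
proof (cases "K = {}")
  case False
  define k0 where "k0 = (LEAST k. k \<in> K)"
  have k0: "k0 \<in> K"
    unfolding k0_def using False LeastI[of "\<lambda>k. k \<in> K"] by auto
  \<comment> \<open>\<open>Suc L\<close> and not \<open>L\<close>: for \<open>L = 0\<close> the set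
    still contains its least element.\<close>
  have "K \<subseteq> {k0..<k0 + Suc L}"
  proof
    fix k assume k: "k \<in> K"
    have "k0 \<le> k"
      unfolding k0_def using k by (rule Least_le)
    then show "k \<in> {k0..<k0 + Suc L}"
      using assms[OF k0 k] by (cases "k = k0") auto
  qed
  then show thesis by (rule that)
next
  case True
  show thesis
    by (rule that[of 0]) (simp add: True)
qed

lemma covering_multiplicity_le:
  assumes "\<And>y. finite {G \<in> \<G>. y \<in> G} \<and> card {G \<in> \<G>. y \<in> G} \<le> M"
  shows "ennreal_of_enat (covering_multiplicity \<G>) \<le> ennreal (real M)"
proof -
  have "covering_multiplicity \<G> \<le> enat M"
    unfolding covering_multiplicity_def using assms by (intro Inf_lower) blast
  then have "ennreal_of_enat (covering_multiplicity \<G>) \<le> ennreal_of_enat (enat M)"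
    by (simp only: ennreal_of_enat_le_iff)
  then show ?thesis
    by (simp add: ennreal_of_nat_eq_real_of_nat)
qed

lemma exists_small_eps:
  fixes d :: real
  assumes "d < real n" "n \<ge> 1"
  obtains eps where "eps > 0" "eps \<le> 1 / (20 * real n)"
    "(5 * real n) ^ n * 4 ^ n * eps powr (real n - d) \<le> 1 / 10"
proof -
  define K where "K = (5 * real n) ^ n * 4 ^ n"
  have K: "K > 0"
    using assms(2) by (simp add: K_def)
  define eps where "eps = min (1 / (20 * real n)) ((1 / (10 * K)) powr (1 / (real n - d)))"
  have eps: "eps > 0" "eps \<le> 1 / (20 * real n)"
    using K assms by (auto simp: eps_def)
  have "eps powr (real n - d) \<le> ((1 / (10 * K)) powr (1 / (real n - d))) powr (real n - d)"
    using eps assms by (intro powr_mono2) (auto simp: eps_def)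
  also have "\<dots> = 1 / (10 * K)"
    using K assms by (simp add: powr_powr)
  finally have "K * eps powr (real n - d) \<le> K * (1 / (10 * K))"
    using K by (intro mult_left_mono) auto
  also have "\<dots> = 1 / 10"
    using K by simp
  finally show thesis
    unfolding K_def by (rule that[OF eps])
qed

section \<open>Constants, construction of the family and its properties\<close>

theorem theorem1p3:
  fixes d c lam :: real
  assumes "0 < d" and "d < real CARD('n::finite)" and "c > 1" and "lam > 0"
  shows "\<exists>C1 C2 C3 :: real. C1 > 0 \<and> C2 > 0 \<and> C3 > 0 \<and>
    (\<forall>S :: (real ^ 'n) set.
       compact S \<longrightarrow> S \<subseteq> unit_cube \<longrightarrow> hausdorff_content d S > 0 \<longrightarrow>
       ennreal lam < hausdorff_content d S / ennreal (c powr d * 6 ^ CARD('n)) \<longrightarrow>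
       (\<exists>\<W> :: (real ^ 'n) set set.
          countable \<W> \<and> (\<forall>\<Omega>\<in>\<W>. \<Omega> \<in> sets borel) \<and>
          interior (dilate c unit_cube) - S = \<Union>\<W> \<and>
          (\<forall>\<Omega>\<in>\<W>. ennreal (1 / C1) * sup_diam \<Omega> \<le> rho_dist S d lam \<Omega> \<and>
                 rho_dist S d lam \<Omega> \<le> ennreal C1 * sup_diam \<Omega>) \<and>
          (\<forall>\<Omega>\<in>\<W>. emeasure lborel \<Omega> \<ge> ennreal C2 * sup_diam \<Omega> ^ CARD('n)) \<and>
          ennreal_of_enat (covering_multiplicity \<W>) \<le> ennreal C3))"
proof -
  have "CARD('n) \<ge> 1"
    by (simp add: Suc_leI)
  then obtain eps where eps: "eps > 0" "eps \<le> 1 / (20 * real CARD('n))"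
      "(5 * real CARD('n)) ^ CARD('n) * 4 ^ CARD('n) * eps powr (real CARD('n) - d) \<le> 1 / 10"
    by (rule exists_small_eps[OF assms(2)])
  \<comment> \<open>At scale \<open>s\<close> the cube that is not thick has side
    \<open>\<kappa> * s\<close>, and its good part avoids all thick cubes of side below
    \<open>e * s\<close>, where \<open>e = eps * \<kappa>\<close>.\<close>
  define \<kappa> where "\<kappa> = (c - 1) / (2 * c)"
  have \<kappa>: "0 < \<kappa>" "\<kappa> \<le> 1"
    using assms(3) by (auto simp: \<kappa>_def field_simps)
  define e where "e = eps * \<kappa>"
  have e: "e > 0"
    using eps \<kappa> by (simp add: e_def)
  have "e \<le> 1"
  proof -
    have "real CARD('n) \<ge> 1"
      using \<open>CARD('n) \<ge> 1\<close> by (simp only: real_of_nat_ge_one_iff)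
    then have "1 \<le> 20 * real CARD('n)"
      by linarith
    then have "1 / (20 * real CARD('n)) \<le> 1"
      by (simp add: divide_le_eq)
    with eps(2) have "eps \<le> 1"
      by (rule order_trans)
    then show ?thesis
      unfolding e_def using \<kappa> by (intro mult_le_one) auto
  qed
  \<comment> \<open>If the ranges from \<open>e * s k\<close> to \<open>2 * s k\<close> for two
    levels share a value, the levels differ by less than \<open>L\<close>.\<close>
  obtain L :: nat where L: "2 / e < 2 ^ L"
    using real_arch_pow[of 2 "2 / e"] by auto
  define C1 where "C1 = max (4 / e) (40 / \<kappa>)"
  define C2 where "C2 = \<kappa> ^ CARD('n) / (10 * 4 ^ CARD('n))"
  define M where "M = Suc L * 5 ^ CARD('n)"
  have "C1 > 0" "C2 > 0"
    using e \<kappa> by (auto simp: C1_def C2_def less_max_iff_disj)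
  have "real M > 0"
    unfolding M_def of_nat_0_less_iff by simp
  define s where "s k = c / 2 ^ k" for k :: nat
  have s: "0 < s k" "s k \<le> c" for k
    using assms(3) by (auto simp: s_def divide_le_eq one_le_power)
  define q :: "real ^ 'n" where "q = (\<chi> i. 1 / 2)"
  have unit: "unit_cube = cube q 1"
    by (simp add: unit_cube_eq q_def)
  have dil: "dilate c unit_cube = cube q c"
    using assms(3) by (simp add: unit dilate_cube)
  \<comment> \<open>All constants are fixed before \<open>S\<close> is introduced, so they depend on
    the dimension, \<open>d\<close>, \<open>c\<close> and \<open>lam\<close> only.\<close>
  have main: "\<exists>\<W> :: (real ^ 'n) set set.
          countable \<W> \<and> (\<forall>\<Omega>\<in>\<W>. \<Omega> \<in> sets borel) \<and>
          interior (dilate c unit_cube) - S = \<Union>\<W> \<and>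
          (\<forall>\<Omega>\<in>\<W>. ennreal (1 / C1) * sup_diam \<Omega> \<le> rho_dist S d lam \<Omega> \<and>
                 rho_dist S d lam \<Omega> \<le> ennreal C1 * sup_diam \<Omega>) \<and>
          (\<forall>\<Omega>\<in>\<W>. emeasure lborel \<Omega> \<ge> ennreal C2 * sup_diam \<Omega> ^ CARD('n)) \<and>
          ennreal_of_enat (covering_multiplicity \<W>) \<le> ennreal (real M)"
    if S: "compact S" "S \<subseteq> unit_cube"
      "ennreal lam < hausdorff_content d S / ennreal (c powr d * 6 ^ CARD('n))"
    for S :: "(real ^ 'n) set"
  proof -
    have S1: "S \<subseteq> cube q 1"
      using S(2) by (simp add: unit)
    note lam = lam_bounds[OF assms(1,3,4) S1 S(3)]
    define U where "U = thick_union S d lam"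
    have U_borel: "U r \<in> sets borel" for r
      unfolding U_def by (rule thick_union_borel[OF S(1) assms(1)])
    have U_mono: "U r \<subseteq> U r'" if "r \<le> r'" for r r'
      unfolding U_def using that by (rule thick_union_mono)
    define D where "D = interior (cube q c) - S"
    have D_borel: "D \<in> sets borel"
      using compact_imp_closed[OF S(1)] by (auto simp: D_def)
    \<comment> \<open>The lower cutoff is \<open>e * s k\<close> and not \<open>s k\<close>, so that
      the good part found near a point outside \<open>U (s k)\<close> is kept. The cube is centered
      at a lattice point within \<open>s k\<close> of that point, and the good part extends at most
      another \<open>s k\<close>, whence the side \<open>4 * s k\<close>.\<close>
    define \<Omega> where "\<Omega> k m = cube (\<chi> i. s k * of_int (m $ i)) (4 * s k) \<inter> D \<inter> U (2 * s k) - U (e * s k)"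
      for k and m :: "int ^ 'n"
    define cell where "cell k x = (\<chi> i. \<lfloor>x $ i / s k\<rfloor>)" for k and x :: "real ^ 'n"
    define \<W> where "\<W> = {\<Omega> k (cell k x) | k x. x \<in> D \<and> x \<in> U (2 * s k) \<and> x \<notin> U (s k)}"
    have cell: "\<bar>x $ i - s k * of_int (cell k x $ i)\<bar> \<le> s k" for x i k
    proof -
      have "of_int \<lfloor>x $ i / s k\<rfloor> * s k \<le> x $ i"
        using of_int_floor_le s(1)[of k] by (simp only: flip: pos_le_divide_eq)
      moreover have "x $ i \<le> (of_int \<lfloor>x $ i / s k\<rfloor> + 1) * s k"
        using less_imp_le[OF floor_less_iff[THEN iffD1, of "x $ i / s k" "\<lfloor>x $ i / s k\<rfloor> + 1"]] s(1)[of k]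
        by (simp flip: pos_divide_le_eq)
      ultimately show ?thesis
        using s(1)[of k] by (simp add: cell_def abs_le_iff algebra_simps)
    qed
    have \<Omega>_borel: "\<Omega> k m \<in> sets borel" for k m
      unfolding \<Omega>_def using U_borel D_borel by auto
    have mem: "x \<in> \<Omega> k (cell k x)" if "x \<in> D" "x \<in> U (2 * s k)" "x \<notin> U (s k)" for x k
    proof -
      have "e * s k \<le> 1 * s k"
        using \<open>e \<le> 1\<close> s(1)[of k] by (intro mult_right_mono) auto
      then have "x \<notin> U (e * s k)"
        using U_mono[of "e * s k" "s k"] that(3) by auto
      moreover have "\<bar>x $ i - s k * of_int (cell k x $ i)\<bar> \<le> 2 * s k" for i
        using cell[of x i k] s(1)[of k] by linarith
      then have "x \<in> cube (\<chi> i. s k * of_int (cell k x $ i)) (4 * s k)"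
        by (simp add: mem_cube)
      ultimately show ?thesis
        using that by (simp add: \<Omega>_def)
    qed
    have piece: "ennreal (1 / C1) * sup_diam W \<le> rho_dist S d lam W"
        "rho_dist S d lam W \<le> ennreal C1 * sup_diam W"
        "ennreal C2 * sup_diam W ^ CARD('n) \<le> emeasure lborel W"
      if W: "W \<in> \<W>" for W
    proof -
      obtain k x where W_eq: "W = \<Omega> k (cell k x)" and x: "x \<in> D" "x \<in> U (2 * s k)" "x \<notin> U (s k)"
        using W by (auto simp: \<W>_def)
      have xq: "x \<in> cube q c"
        using x(1) interior_subset by (auto simp: D_def)
      have "\<kappa> * s k = (c - 1) / (2 * c) * s k"
        by (simp add: \<kappa>_def)
      from good_part_near_point[OF assms(1,2,4) lam(1) eps assms(3) S1 s xq x(2,3)[unfolded U_def] this]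
      obtain G where G: "G \<subseteq> interior (cube q c) \<inter> cube x (2 * (\<kappa> * s k)) - S"
          "G \<subseteq> U (2 * s k) - U (eps * (\<kappa> * s k))"
          "ennreal ((\<kappa> * s k) ^ CARD('n) / 10) \<le> emeasure lborel G"
        unfolding U_def by (metis (no_types))
      have "G \<subseteq> W"
      proof
        fix y assume y: "y \<in> G"
        have "\<bar>y $ i - s k * of_int (cell k x $ i)\<bar> \<le> 2 * s k" for i
        proof -
          have "\<bar>y $ i - x $ i\<bar> \<le> \<kappa> * s k"
            using y G(1) by (auto simp: mem_cube)
          also have "\<dots> \<le> 1 * s k"
            using \<kappa> s(1)[of k] by (intro mult_right_mono) auto
          finally show ?thesis
            using cell[of x i k] by linarith
        qed
        then have "y \<in> cube (\<chi> i. s k * of_int (cell k x $ i)) (4 * s k)"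
          by (simp add: mem_cube)
        then show "y \<in> W"
          using y G(1,2) by (auto simp: W_eq \<Omega>_def D_def e_def mult.assoc)
      qed
      have W_sub: "W \<subseteq> cube (\<chi> i. s k * of_int (cell k x $ i)) (4 * s k)" "W \<inter> S = {}"
          "W \<subseteq> thick_union S d lam (2 * s k)" "W \<inter> thick_union S d lam (e * s k) = {}"
        by (auto simp: W_eq \<Omega>_def D_def U_def)
      have "W \<in> sets borel"
        by (simp add: W_eq \<Omega>_borel)
      note * = comparable_piece[OF assms(1,4) s(1) \<kappa>(1) e \<open>W \<in> sets borel\<close> W_sub \<open>G \<subseteq> W\<close> G(3), of C1]
      show "ennreal (1 / C1) * sup_diam W \<le> rho_dist S d lam W"
        "rho_dist S d lam W \<le> ennreal C1 * sup_diam W"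
        "ennreal C2 * sup_diam W ^ CARD('n) \<le> emeasure lborel W"
        using * by (simp_all add: C1_def C2_def)
    qed
    have union: "D = \<Union>\<W>"
    proof
      show "\<Union>\<W> \<subseteq> D"
        by (auto simp: \<W>_def \<Omega>_def)
      show "D \<subseteq> \<Union>\<W>"
      proof
        fix x assume x: "x \<in> D"
        have xq: "x \<in> cube q c" "x \<notin> S"
          using x interior_subset by (auto simp: D_def)
        obtain \<eta> where \<eta>: "\<eta> > 0" "x \<notin> U \<eta>"
          using not_in_small_thick_union[OF compact_imp_closed[OF S(1)] xq(2) assms(1,4)]
          unfolding U_def by blast
        \<comment> \<open>\<open>cube q c\<close> contains all of \<open>S\<close> and is thick, so
          the search for the level of \<open>x\<close> can start at \<open>2 * c\<close>.\<close>
        have "cube q 1 \<subseteq> cube q c"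
          using assms(3) by (auto simp: mem_cube_infnorm)
        then have "cube q c \<inter> S = S"
          using S1 by blast
        then have "cube q c \<in> thick_cubes S d lam"
          using lam(2) assms(3) by (simp add: cube_mem_thick_cubes_iff)
        then have "x \<in> U (2 * c)"
          unfolding U_def mem_thick_union using xq(1) assms(3)
          by (intro exI[of _ q] exI[of _ c]) simp
        then obtain k where "x \<in> U (2 * (c / 2 ^ k))" "x \<notin> U (c / 2 ^ k)"
          by (rule exists_dyadic_level[of "\<lambda>r. x \<in> U r", OF _ \<eta>(2,1)]) (use U_mono in blast)
        then have k: "x \<in> U (2 * s k)" "x \<notin> U (s k)"
          by (simp_all add: s_def)
        have "\<Omega> k (cell k x) \<in> \<W>"
          unfolding \<W>_def using x k by blast
        with mem[OF x k] show "x \<in> \<Union>\<W>"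
          by blast
      qed
    qed
    have mult: "finite {G \<in> \<W>. y \<in> G} \<and> card {G \<in> \<W>. y \<in> G} \<le> M" for y
    proof -
      define K where "K = {k. y \<in> U (2 * s k) \<and> y \<notin> U (e * s k)}"
      have "k' - k < L" if k: "k \<in> K" "k' \<in> K" "k < k'" for k k'
      proof -
        \<comment> \<open>Otherwise the upper condition on \<open>y\<close> at the finer level
          \<open>k'\<close> would violate the lower cutoff at level \<open>k\<close>.\<close>
        have "e * s k < 2 * s k'"
        proof (rule ccontr)
          assume "\<not> e * s k < 2 * s k'"
          then have "U (2 * s k') \<subseteq> U (e * s k)"
            by (intro U_mono) simp
          with k show False
            by (auto simp: K_def)
        qed
        moreover have "(2 :: real) ^ k' = 2 ^ k * 2 ^ (k' - k)"
          using k(3) by (simp flip: power_add)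
        ultimately have "e < 2 / 2 ^ (k' - k)"
          using assms(3) by (simp add: s_def field_simps)
        then have "2 ^ (k' - k) < 2 / e"
          using e by (simp add: field_simps)
        also note L
        finally show ?thesis
          by simp
      qed
      then obtain k0 where k0: "K \<subseteq> {k0..<k0 + Suc L}"
        by (rule nat_subset_interval_if_diff_less)
      \<comment> \<open>Pieces through \<open>y\<close> are parametrised by the level and the offset
        of their cell from the cell of \<open>y\<close>.\<close>
      define f where "f = (\<lambda>(k, v). \<Omega> k (\<chi> i. \<lfloor>y $ i / s k\<rfloor> + v i))"
      define T where "T = {k0..<k0 + Suc L} \<times> (PiE (UNIV :: 'n set) (\<lambda>_. {-2..2 :: int}))"
      have sub: "{G \<in> \<W>. y \<in> G} \<subseteq> f ` T"
      proof
        fix G assume "G \<in> {G \<in> \<W>. y \<in> G}"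
        then obtain k m where G: "G = \<Omega> k m" "y \<in> \<Omega> k m"
          by (auto simp: \<W>_def)
        then have "k \<in> K"
          by (auto simp: \<Omega>_def K_def)
        have off: "m $ i - \<lfloor>y $ i / s k\<rfloor> \<in> {-2..2}" for i
          using G(2) s(1)[of k] by (intro floor_grid_offset) (auto simp: \<Omega>_def mem_cube)
        have "(\<chi> i. \<lfloor>y $ i / s k\<rfloor> + (m $ i - \<lfloor>y $ i / s k\<rfloor>)) = m"
          by (simp add: vec_eq_iff)
        then have "G = f (k, \<lambda>i. m $ i - \<lfloor>y $ i / s k\<rfloor>)"
          by (simp add: f_def G(1))
        moreover have "(k, \<lambda>i. m $ i - \<lfloor>y $ i / s k\<rfloor>) \<in> T"
          using off k0 \<open>k \<in> K\<close> by (auto simp: T_def PiE_def)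
        ultimately show "G \<in> f ` T"
          by (rule image_eqI)
      qed
      have "finite T"
        unfolding T_def by (intro finite_cartesian_product finite_PiE) auto
      moreover have "card T = M"
        by (simp add: T_def M_def card_cartesian_product card_PiE)
      ultimately have "finite (f ` T)" "card (f ` T) \<le> M"
        using card_image_le[of T f] by auto
      then show ?thesis
        using sub card_mono[of "f ` T" "{G \<in> \<W>. y \<in> G}"] finite_subset[OF sub] by linarith
    qed
    have "\<W> \<subseteq> range (\<lambda>(k, m). \<Omega> k m)"
      by (force simp: \<W>_def)
    then have count: "countable \<W>"
      by (rule countable_subset) simp
    have borel: "\<forall>W\<in>\<W>. W \<in> sets borel"
      using \<Omega>_borel by (auto simp: \<W>_def)
    show ?thesis
      using count borel union piece covering_multiplicity_le[OF mult]
      by (intro exI[of _ \<W>]) (simp add: dil D_def)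
  qed
  show ?thesis
  proof (rule exI[of _ C1], rule exI[of _ C2], rule exI[of _ "real M"], intro conjI allI impI)
    show "C1 > 0" "C2 > 0" "real M > 0" by fact+
  qed (rule main)
qed

end
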